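(* Let $P:\mathbb C^{\mathrm{op}}\to\mathbf{Pos}$ be a primary doctrine, $X$ an object of $\mathbb C$ and $\varphi\in P(X)$. The 1-arrow $(F_X,\mathfrak f):P\to P_{(X,\varphi)}$ and the $\mathbb C_X$-arrow $\mathrm{id}_X:\mathbf t_{\mathbb C_X}\rightsquigarrow X$ satisfy $\top\le P_{(X,\varphi)}(\mathrm{id}_X)\mathfrak f_X(\varphi)$ in $P_{(X,\varphi)}(\mathbf t_{\mathbb C_X})$, and they are universal with respect to this property: for every primary doctrine $R:\mathbb D^{\mathrm{op}}\to\mathbf{Pos}$, every primary 1-arrow $(G,\mathfrak g):P\to R$ and every $\mathbb D$-arrow $c:\mathbf t_{\mathbb D}\to G(X)$ such that $\top\le R(c)\mathfrak g_X(\varphi)$ in $R(\mathbf t_{\mathbb D})$, there exists a primary 1-arrow $(G',\mathfrak g'):P_{(X,\varphi)}\to R$, unique up to a unique natural isomorphism, such that $(G',\mathfrak g')\circ(F_X,\mathfrak f)=(G,\mathfrak g)$ and $G'(\mathrm{id}_X)=c$.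
   Context: A doctrine is a functor $P:\mathbb C^{\mathrm{op}}\to\mathbf{Pos}$ with $\mathbb C$ a category with finite products and $\mathbf{Pos}$ the category of posets and monotone maps; the maps $P(f)$ are called reindexings. It is primary if every $P(A)$ has finite meets ($\wedge$, $\top$) and all reindexings preserve them. A 1-arrow (doctrine homomorphism) from $P:\mathbb C^{\mathrm{op}}\to\mathbf{Pos}$ to $R:\mathbb D^{\mathrm{op}}\to\mathbf{Pos}$ is a pair $(F,\mathfrak f)$ with $F:\mathbb C\to\mathbb D$ a finite-product-preserving functor and $\mathfrak f:P\to R\circ F^{\mathrm{op}}$ natural; it is primary if $P,R$ are primary and each $\mathfrak f_A$ preserves finite meets. Composition: $(G,\mathfrak g)\circ(F,\mathfrak f)=(GF,(\mathfrak g_{FA}\mathfrak f_A)_A)$. A 2-cell $(F,\mathfrak f)\Rightarrow(G,\mathfrak g):P\to R$ is a natural transformation $\theta:F\to G$ with $\mathfrak f_A(\alpha)\le R(\theta_A)(\mathfrak g_A(\alpha))$ for all $A$ and $\alpha\in P(A)$. Kleisli doctrine. Given a primary doctrine $P:\mathbb C^{\mathrm{op}}\to\mathbf{Pos}$, an object $X$ of $\mathbb C$ and $\varphi\in P(X)$: the category $\mathbb C_X$ has the same objects as $\mathbb C$; an arrow $g:A\rightsquigarrow B$ in $\mathbb C_X$ is a $\mathbb C$-arrow $g:X\times A\to B$; the identity of $A$ is $\mathrm{pr}_2:X\times A\to A$; the composite of $g:A\rightsquigarrow B$ and $h:B\rightsquigarrow C$ is $h\langle\mathrm{pr}_1,g\rangle$.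 It has finite products, given on objects by those of $\mathbb C$. The doctrine $P_{(X,\varphi)}:\mathbb C_X^{\mathrm{op}}\to\mathbf{Pos}$ has $P_{(X,\varphi)}(A)=\{\alpha\in P(X\times A)\mid\alpha\le P(\mathrm{pr}_1)(\varphi)\}$ with the order of $P(X\times A)$, and reindexing along $g:A\rightsquigarrow B$ is the restriction of $P(\langle\mathrm{pr}_1,g\rangle)$. The 1-arrow $(F_X,\mathfrak f):P\to P_{(X,\varphi)}$: $F_X:\mathbb C\to\mathbb C_X$ is the identity on objects and sends $f:A\to B$ to $f\,\mathrm{pr}_2:A\rightsquigarrow B$; $\mathfrak f_A(\alpha)=P(\mathrm{pr}_1)(\varphi)\wedge P(\mathrm{pr}_2)(\alpha)$, for $\mathrm{pr}_1,\mathrm{pr}_2$ the projections from $X\times A$. $P_{(X,\varphi)}$ is a primary doctrine and $(F_X,\mathfrak f)$ is primary. Conventions: $\mathbf t$ denotes a terminal object (subscripts indicate the category). The arrow $\mathrm{id}_X:\mathbf t\rightsquigarrow X$ of $\mathbb C_X$ is the $\mathbb C$-arrow $\mathrm{pr}_1:X\times\mathbf t\to X$, where $X\times\mathbf t$ is identified with $X$. The arrow $G'(\mathrm{id}_X)$ is regarded as having domain $\mathbf t_{\mathbb D}$ via the canonical isomorphism $G'(\mathbf t)\cong\mathbf t_{\mathbb D}$. "Unique up to a unique natural isomorphism" means: for any two such primary 1-arrows there is exactly one invertible 2-cell between them whose whiskering with $(F_X,\mathfrak f)$ is the identity. *)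

theory Defs
  imports "HOL-Algebra.Lattice"
begin

section \<open>Categories with finite products\<close>

record ('o, 'm) category =
  Obj :: "'o set"
  Arr :: "'m set"
  Dom :: "'m \<Rightarrow> 'o"
  Cod :: "'m \<Rightarrow> 'o"
  Ide :: "'o \<Rightarrow> 'm"
  Comp :: "'m \<Rightarrow> 'm \<Rightarrow> 'm"  (infixr \<open>\<cdot>\<index>\<close> 70)

definition homset :: "('o, 'm, 'x) category_scheme \<Rightarrow> 'o \<Rightarrow> 'o \<Rightarrow> 'm set"
  where "homset C A B = {f \<in> Arr C. Dom C f = A \<and> Cod C f = B}"

locale category =
  fixes C :: "('o, 'm, 'x) category_scheme" (structure)
  assumes dom_obj: "f \<in> Arr C \<Longrightarrow> Dom C f \<in> Obj C"
    and cod_obj: "f \<in> Arr C \<Longrightarrow> Cod C f \<in> Obj C"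
    and ide_hom: "A \<in> Obj C \<Longrightarrow> Ide C A \<in> homset C A A"
    and comp_hom: "\<lbrakk>f \<in> homset C A B; g \<in> homset C B D\<rbrakk> \<Longrightarrow> g \<cdot> f \<in> homset C A D"
    and comp_ide: "f \<in> homset C A B \<Longrightarrow> f \<cdot> Ide C A = f"
    and ide_comp: "f \<in> homset C A B \<Longrightarrow> Ide C B \<cdot> f = f"
    and comp_assoc: "\<lbrakk>f \<in> homset C A B; g \<in> homset C B D; h \<in> homset C D E\<rbrakk>
      \<Longrightarrow> (h \<cdot> g) \<cdot> f = h \<cdot> (g \<cdot> f)"

definition is_terminal :: "('o, 'm, 'x) category_scheme \<Rightarrow> 'o \<Rightarrow> bool"
  where "is_terminal C T \<longleftrightarrow> T \<in> Obj C \<and> (\<forall>A \<in> Obj C. \<exists>!f. f \<in> homset C A T)"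

definition is_product ::
    "('o, 'm, 'x) category_scheme \<Rightarrow> 'o \<Rightarrow> 'o \<Rightarrow> 'o \<Rightarrow> 'm \<Rightarrow> 'm \<Rightarrow> bool"
  where "is_product C A B Q p q \<longleftrightarrow>
    A \<in> Obj C \<and> B \<in> Obj C \<and> Q \<in> Obj C \<and> p \<in> homset C Q A \<and> q \<in> homset C Q B \<and>
    (\<forall>Z \<in> Obj C. \<forall>f \<in> homset C Z A. \<forall>g \<in> homset C Z B.
      \<exists>!h. h \<in> homset C Z Q \<and> p \<cdot>\<^bsub>C\<^esub> h = f \<and> q \<cdot>\<^bsub>C\<^esub> h = g)"

text \<open>The terminal object and the binary products are chosen, since the Kleisli category below
  is built from a particular product \<open>X \<times> A\<close>. Functors are not required to preserve the choice.\<close>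

record ('o, 'm) fp_category = "('o, 'm) category" +
  Trm :: 'o
  Prd :: "'o \<Rightarrow> 'o \<Rightarrow> 'o"
  Pr1 :: "'o \<Rightarrow> 'o \<Rightarrow> 'm"
  Pr2 :: "'o \<Rightarrow> 'o \<Rightarrow> 'm"

locale fp_category = category C
  for C :: "('o, 'm, 'x) fp_category_scheme" (structure) +
  assumes trm_terminal: "is_terminal C (Trm C)"
    and prd_product: "\<lbrakk>A \<in> Obj C; B \<in> Obj C\<rbrakk>
      \<Longrightarrow> is_product C A B (Prd C A B) (Pr1 C A B) (Pr2 C A B)"

definition tuple :: "('o, 'm, 'x) fp_category_scheme \<Rightarrow> 'm \<Rightarrow> 'm \<Rightarrow> 'm"  (\<open>\<langle>_,/ _\<rangle>\<index>\<close>)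
  where "\<langle>f, g\<rangle>\<^bsub>C\<^esub> =
    (THE h. h \<in> homset C (Dom C f) (Prd C (Cod C f) (Cod C g)) \<and>
      Pr1 C (Cod C f) (Cod C g) \<cdot>\<^bsub>C\<^esub> h = f \<and> Pr2 C (Cod C f) (Cod C g) \<cdot>\<^bsub>C\<^esub> h = g)"

definition bang :: "('o, 'm, 'x) fp_category_scheme \<Rightarrow> 'o \<Rightarrow> 'm"
  where "bang C A = (THE f. f \<in> homset C A (Trm C))"

definition inverse_arrow :: "('o, 'm, 'x) category_scheme \<Rightarrow> 'm \<Rightarrow> 'm"
  where "inverse_arrow C f =
    (THE g. g \<in> homset C (Cod C f) (Dom C f) \<and>
      g \<cdot>\<^bsub>C\<^esub> f = Ide C (Dom C f) \<and> f \<cdot>\<^bsub>C\<^esub> g = Ide C (Cod C f))"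


section \<open>Functors\<close>

text \<open>Object and arrow maps, like all components of the morphisms below, are extensional
  (\<open>undefined\<close> off their domain), so that equality of HOL functions is equality of morphisms.\<close>

record ('o, 'm, 'o2, 'm2) fctr =
  omap :: "'o \<Rightarrow> 'o2"
  amap :: "'m \<Rightarrow> 'm2"

definition is_functor ::
    "('o, 'm, 'x) category_scheme \<Rightarrow> ('o2, 'm2, 'y) category_scheme \<Rightarrow> ('o, 'm, 'o2, 'm2) fctr \<Rightarrow> bool"
  where "is_functor C D F \<longleftrightarrow> category C \<and> category D \<and>
    omap F \<in> Obj C \<rightarrow>\<^sub>E Obj D \<and>
    amap F \<in> (\<Pi>\<^sub>E f \<in> Arr C. homset D (omap F (Dom C f)) (omap F (Cod C f))) \<and>
    (\<forall>A \<in> Obj C. amap F (Ide C A) = Ide D (omap F A)) \<and>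
    (\<forall>f \<in> Arr C. \<forall>g \<in> Arr C. Cod C f = Dom C g \<longrightarrow>
      amap F (g \<cdot>\<^bsub>C\<^esub> f) = amap F g \<cdot>\<^bsub>D\<^esub> amap F f)"

definition preserves_finite_products ::
    "('o, 'm, 'x) category_scheme \<Rightarrow> ('o2, 'm2, 'y) category_scheme \<Rightarrow> ('o, 'm, 'o2, 'm2) fctr \<Rightarrow> bool"
  where "preserves_finite_products C D F \<longleftrightarrow>
    (\<forall>T. is_terminal C T \<longrightarrow> is_terminal D (omap F T)) \<and>
    (\<forall>A B Q p q. is_product C A B Q p q \<longrightarrow>
      is_product D (omap F A) (omap F B) (omap F Q) (amap F p) (amap F q))"

definition is_nat_trans ::
    "('o, 'm, 'x) category_scheme \<Rightarrow> ('o2, 'm2, 'y) category_scheme \<Rightarrow>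
     ('o, 'm, 'o2, 'm2) fctr \<Rightarrow> ('o, 'm, 'o2, 'm2) fctr \<Rightarrow> ('o \<Rightarrow> 'm2) \<Rightarrow> bool"
  where "is_nat_trans C D F G \<theta> \<longleftrightarrow>
    \<theta> \<in> (\<Pi>\<^sub>E A \<in> Obj C. homset D (omap F A) (omap G A)) \<and>
    (\<forall>f \<in> Arr C. amap G f \<cdot>\<^bsub>D\<^esub> \<theta> (Dom C f) = \<theta> (Cod C f) \<cdot>\<^bsub>D\<^esub> amap F f)"


section \<open>Doctrines\<close>

record ('o, 'm, 'p) doctrine =
  base :: "('o, 'm) fp_category"
  fib :: "'o \<Rightarrow> 'p gorder"
  reindex :: "'m \<Rightarrow> 'p \<Rightarrow> 'p"

locale doctrine =
  fixes P :: "('o, 'm, 'p) doctrine"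
  assumes base_fp: "fp_category (base P)"
    and fib_poset: "A \<in> Obj (base P) \<Longrightarrow> partial_order (fib P A)"
    and reindex_closed: "f \<in> homset (base P) A B
      \<Longrightarrow> reindex P f \<in> carrier (fib P B) \<rightarrow> carrier (fib P A)"
    and reindex_mono: "f \<in> homset (base P) A B \<Longrightarrow> isotone (fib P B) (fib P A) (reindex P f)"
    and reindex_ide: "\<lbrakk>A \<in> Obj (base P); \<alpha> \<in> carrier (fib P A)\<rbrakk>
      \<Longrightarrow> reindex P (Ide (base P) A) \<alpha> = \<alpha>"
    and reindex_comp: "\<lbrakk>f \<in> homset (base P) A B; g \<in> homset (base P) B C; \<gamma> \<in> carrier (fib P C)\<rbrakk>
      \<Longrightarrow> reindex P (g \<cdot>\<^bsub>base P\<^esub> f) \<gamma> = reindex P f (reindex P g \<gamma>)"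

locale finite_meet_poset = lower_semilattice + weak_partial_order_top

definition preserves_finite_meets :: "'p gorder \<Rightarrow> 'q gorder \<Rightarrow> ('p \<Rightarrow> 'q) \<Rightarrow> bool"
  where "preserves_finite_meets L M h \<longleftrightarrow> h \<top>\<^bsub>L\<^esub> = \<top>\<^bsub>M\<^esub> \<and>
    (\<forall>x \<in> carrier L. \<forall>y \<in> carrier L. h (x \<sqinter>\<^bsub>L\<^esub> y) = h x \<sqinter>\<^bsub>M\<^esub> h y)"

locale primary_doctrine = doctrine +
  assumes fib_meets: "A \<in> Obj (base P) \<Longrightarrow> finite_meet_poset (fib P A)"
    and reindex_meets: "f \<in> homset (base P) A B
      \<Longrightarrow> preserves_finite_meets (fib P B) (fib P A) (reindex P f)"


section \<open>1-arrows and 2-cells\<close>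

type_synonym ('o, 'm, 'p, 'o2, 'm2, 'p2) one_arr =
  "('o, 'm, 'o2, 'm2) fctr \<times> ('o \<Rightarrow> 'p \<Rightarrow> 'p2)"

definition one_arrow ::
    "('o, 'm, 'p) doctrine \<Rightarrow> ('o2, 'm2, 'p2) doctrine \<Rightarrow> ('o, 'm, 'p, 'o2, 'm2, 'p2) one_arr \<Rightarrow> bool"
  where "one_arrow P R = (\<lambda>(F, \<ff>).
    doctrine P \<and> doctrine R \<and>
    is_functor (base P) (base R) F \<and> preserves_finite_products (base P) (base R) F \<and>
    \<ff> \<in> (\<Pi>\<^sub>E A \<in> Obj (base P). carrier (fib P A) \<rightarrow>\<^sub>E carrier (fib R (omap F A))) \<and>
    (\<forall>A \<in> Obj (base P). isotone (fib P A) (fib R (omap F A)) (\<ff> A)) \<and>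
    (\<forall>A \<in> Obj (base P). \<forall>B \<in> Obj (base P). \<forall>f \<in> homset (base P) A B. \<forall>\<beta> \<in> carrier (fib P B).
      \<ff> A (reindex P f \<beta>) = reindex R (amap F f) (\<ff> B \<beta>)))"

definition primary_one_arrow ::
    "('o, 'm, 'p) doctrine \<Rightarrow> ('o2, 'm2, 'p2) doctrine \<Rightarrow> ('o, 'm, 'p, 'o2, 'm2, 'p2) one_arr \<Rightarrow> bool"
  where "primary_one_arrow P R = (\<lambda>(F, \<ff>).
    one_arrow P R (F, \<ff>) \<and> primary_doctrine P \<and> primary_doctrine R \<and>
    (\<forall>A \<in> Obj (base P). preserves_finite_meets (fib P A) (fib R (omap F A)) (\<ff> A)))"

definition one_arrow_comp ::
    "('o, 'm, 'p) doctrine \<Rightarrow> ('o2, 'm2, 'p2, 'o3, 'm3, 'p3) one_arr \<Rightarrow>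
     ('o, 'm, 'p, 'o2, 'm2, 'p2) one_arr \<Rightarrow> ('o, 'm, 'p, 'o3, 'm3, 'p3) one_arr"
  where "one_arrow_comp P = (\<lambda>(G, \<gg>) (F, \<ff>).
    (\<lparr>omap = compose (Obj (base P)) (omap G) (omap F),
      amap = compose (Arr (base P)) (amap G) (amap F)\<rparr>,
     \<lambda>A \<in> Obj (base P). compose (carrier (fib P A)) (\<gg> (omap F A)) (\<ff> A)))"

definition two_cell ::
    "('o, 'm, 'p) doctrine \<Rightarrow> ('o2, 'm2, 'p2) doctrine \<Rightarrow>
     ('o, 'm, 'p, 'o2, 'm2, 'p2) one_arr \<Rightarrow> ('o, 'm, 'p, 'o2, 'm2, 'p2) one_arr \<Rightarrow>
     ('o \<Rightarrow> 'm2) \<Rightarrow> bool"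
  where "two_cell P R = (\<lambda>(F, \<ff>) (G, \<gg>) \<theta>.
    is_nat_trans (base P) (base R) F G \<theta> \<and>
    (\<forall>A \<in> Obj (base P). \<forall>\<alpha> \<in> carrier (fib P A).
      \<ff> A \<alpha> \<sqsubseteq>\<^bsub>fib R (omap F A)\<^esub> reindex R (\<theta> A) (\<gg> A \<alpha>)))"

definition id_two_cell ::
    "('o, 'm, 'p) doctrine \<Rightarrow> ('o2, 'm2, 'p2) doctrine \<Rightarrow>
     ('o, 'm, 'p, 'o2, 'm2, 'p2) one_arr \<Rightarrow> 'o \<Rightarrow> 'm2"
  where "id_two_cell P R = (\<lambda>(F, \<ff>). \<lambda>A \<in> Obj (base P). Ide (base R) (omap F A))"

definition vertical_comp ::
    "('o, 'm, 'p) doctrine \<Rightarrow> ('o2, 'm2, 'p2) doctrine \<Rightarrow> ('o \<Rightarrow> 'm2) \<Rightarrow> ('o \<Rightarrow> 'm2) \<Rightarrow> 'o \<Rightarrow> 'm2"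
  where "vertical_comp P R \<psi> \<theta> = (\<lambda>A \<in> Obj (base P). \<psi> A \<cdot>\<^bsub>base R\<^esub> \<theta> A)"

definition invertible_two_cell ::
    "('o, 'm, 'p) doctrine \<Rightarrow> ('o2, 'm2, 'p2) doctrine \<Rightarrow>
     ('o, 'm, 'p, 'o2, 'm2, 'p2) one_arr \<Rightarrow> ('o, 'm, 'p, 'o2, 'm2, 'p2) one_arr \<Rightarrow>
     ('o \<Rightarrow> 'm2) \<Rightarrow> bool"
  where "invertible_two_cell P R H K \<theta> \<longleftrightarrow> two_cell P R H K \<theta> \<and>
    (\<exists>\<psi>. two_cell P R K H \<psi> \<and>
      vertical_comp P R \<psi> \<theta> = id_two_cell P R H \<and> vertical_comp P R \<theta> \<psi> = id_two_cell P R K)"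

definition whisker ::
    "('o, 'm, 'p) doctrine \<Rightarrow> ('o2 \<Rightarrow> 'm3) \<Rightarrow> ('o, 'm, 'p, 'o2, 'm2, 'p2) one_arr \<Rightarrow> 'o \<Rightarrow> 'm3"
  where "whisker P \<theta> = (\<lambda>(F, \<ff>). compose (Obj (base P)) \<theta> (omap F))"


section \<open>The Kleisli doctrine\<close>

text \<open>An arrow \<open>A \<leadsto> B\<close> is a \<open>C\<close>-arrow \<open>g : X \<times> A \<rightarrow> B\<close>; it is stored as the pair \<open>(A, g)\<close>
  because \<open>X \<times> A\<close> need not determine \<open>A\<close>.\<close>

definition kleisli_cat :: "('o, 'm) fp_category \<Rightarrow> 'o \<Rightarrow> ('o, 'o \<times> 'm) fp_category"
  where "kleisli_cat C X = \<lparr>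
    Obj = Obj C,
    Arr = {(A, g). A \<in> Obj C \<and> g \<in> Arr C \<and> Dom C g = Prd C X A},
    Dom = (\<lambda>(A, g). A),
    Cod = (\<lambda>(A, g). Cod C g),
    Ide = (\<lambda>A. (A, Pr2 C X A)),
    Comp = (\<lambda>(B, h) (A, g). (A, h \<cdot>\<^bsub>C\<^esub> \<langle>Pr1 C X A, g\<rangle>\<^bsub>C\<^esub>)),
    Trm = Trm C,
    Prd = Prd C,
    Pr1 = (\<lambda>A B. (Prd C A B, Pr1 C A B \<cdot>\<^bsub>C\<^esub> Pr2 C X (Prd C A B))),
    Pr2 = (\<lambda>A B. (Prd C A B, Pr2 C A B \<cdot>\<^bsub>C\<^esub> Pr2 C X (Prd C A B)))\<rparr>"

definition kleisli_doctrine ::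
    "('o, 'm, 'p) doctrine \<Rightarrow> 'o \<Rightarrow> 'p \<Rightarrow> ('o, 'o \<times> 'm, 'p) doctrine"
  where "kleisli_doctrine P X \<phi> = \<lparr>
    base = kleisli_cat (base P) X,
    fib = (\<lambda>A. (fib P (Prd (base P) X A))\<lparr>carrier :=
      {\<alpha> \<in> carrier (fib P (Prd (base P) X A)).
        \<alpha> \<sqsubseteq>\<^bsub>fib P (Prd (base P) X A)\<^esub> reindex P (Pr1 (base P) X A) \<phi>}\<rparr>),
    reindex = (\<lambda>(A, g). reindex P \<langle>Pr1 (base P) X A, g\<rangle>\<^bsub>base P\<^esub>)\<rparr>"

definition kleisli_functor :: "('o, 'm) fp_category \<Rightarrow> 'o \<Rightarrow> ('o, 'm, 'o, 'o \<times> 'm) fctr"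
  where "kleisli_functor C X = \<lparr>
    omap = (\<lambda>A \<in> Obj C. A),
    amap = (\<lambda>f \<in> Arr C. (Dom C f, f \<cdot>\<^bsub>C\<^esub> Pr2 C X (Dom C f)))\<rparr>"

definition kleisli_one_arrow ::
    "('o, 'm, 'p) doctrine \<Rightarrow> 'o \<Rightarrow> 'p \<Rightarrow> ('o, 'm, 'p, 'o, 'o \<times> 'm, 'p) one_arr"
  where "kleisli_one_arrow P X \<phi> =
    (kleisli_functor (base P) X,
     \<lambda>A \<in> Obj (base P). \<lambda>\<alpha> \<in> carrier (fib P A).
       reindex P (Pr1 (base P) X A) \<phi> \<sqinter>\<^bsub>fib P (Prd (base P) X A)\<^esub>
       reindex P (Pr2 (base P) X A) \<alpha>)"

definition generic_element :: "('o, 'm) fp_category \<Rightarrow> 'o \<Rightarrow> 'o \<times> 'm"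
  where "generic_element C X = (Trm C, Pr1 C X (Trm C))"

text \<open>The second argument is a functor \<open>G : C \<rightarrow> D\<close>, and the last an arrow out of \<open>G t\<^sub>C\<close>, which is
  precomposed with the canonical isomorphism \<open>t\<^sub>D \<cong> G t\<^sub>C\<close>.\<close>

definition from_terminal ::
    "('o, 'm, 'x) fp_category_scheme \<Rightarrow> ('o2, 'm2, 'y) fp_category_scheme \<Rightarrow>
     ('o, 'm, 'o2, 'm2) fctr \<Rightarrow> 'm2 \<Rightarrow> 'm2"
  where "from_terminal C D G a = a \<cdot>\<^bsub>D\<^esub> inverse_arrow D (bang D (omap G (Trm C)))"

definition kleisli_extension ::
    "('o, 'm, 'p) doctrine \<Rightarrow> 'o \<Rightarrow> 'p \<Rightarrow> ('o2, 'm2, 'p2) doctrine \<Rightarrow>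
     ('o, 'm, 'p, 'o2, 'm2, 'p2) one_arr \<Rightarrow> 'm2 \<Rightarrow> ('o, 'o \<times> 'm, 'p, 'o2, 'm2, 'p2) one_arr \<Rightarrow> bool"
  where "kleisli_extension P X \<phi> R H c H' \<longleftrightarrow>
    primary_one_arrow (kleisli_doctrine P X \<phi>) R H' \<and>
    one_arrow_comp P H' (kleisli_one_arrow P X \<phi>) = H \<and>
    from_terminal (kleisli_cat (base P) X) (base R) (fst H')
      (amap (fst H') (generic_element (base P) X)) = c"

end

theory Submission
  imports Defs
begin

text \<open>
  A Kleisli arrow \<open>g : A \<leadsto> B\<close> is \<open>F\<^sub>X(g) : X \<times> A \<leadsto> B\<close> precomposed with the arrow
  \<open>\<langle>id\<^sub>X \<circ> !, id\<rangle> : A \<leadsto> X \<times> A\<close>. An extension \<open>(G', \<gg>')\<close> must send the latter to the arrow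
  \<open>u\<^sub>A = \<langle>c \<circ> !, id\<rangle> : G(A) \<rightarrow> G(X \<times> A)\<close>, where \<open>G(X \<times> A)\<close> is regarded as the product of \<open>G(X)\<close>
  and \<open>G(A)\<close>. This forces \<open>G'(g) = G(g) \<circ> u\<^sub>A\<close> and \<open>\<gg>'\<^sub>A(\<alpha>) = R(u\<^sub>A)(\<gg>(\<alpha>))\<close>, and conversely these formulas
  define a primary 1-arrow; it preserves \<open>\<top>\<close> because \<open>\<top> \<le> R(c)(\<gg>\<^sub>X(\<phi>))\<close>. The extension is thus unique
  on the nose, and any 2-cell that becomes the identity after whiskering with \<open>(F\<^sub>X, \<ff>)\<close> is the identity,
  since \<open>F\<^sub>X\<close> is the identity on objects.
\<close>

section \<open>Categories with chosen finite products\<close>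

lemma mem_homset: "f \<in> homset C A B \<longleftrightarrow> f \<in> Arr C \<and> Dom C f = A \<and> Cod C f = B"
  by (simp add: homset_def)

context category
begin

declare dom_obj [simp] cod_obj [simp]

text \<open>The rules in this context restate the axioms with equations on \<open>Dom\<close> and
  \<open>Cod\<close> in place of \<open>homset\<close> membership, so that the simplifier can check
  that arrows are composable. Composites are normalised by bracketing to the right.\<close>

lemma ide_simps [simp]:
  assumes "A \<in> Obj C"
  shows "Ide C A \<in> Arr C" "Dom C (Ide C A) = A" "Cod C (Ide C A) = A"
  using ide_hom[OF assms] by (auto simp: mem_homset)

lemma comp_simps [simp]:
  assumes "f \<in> Arr C" "g \<in> Arr C" "Dom C g = Cod C f"
  shows "g \<cdot> f \<in> Arr C" "Dom C (g \<cdot> f) = Dom C f" "Cod C (g \<cdot> f) = Cod C g"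
  using comp_hom[of f "Dom C f" "Cod C f" g "Cod C g"] assms by (auto simp: mem_homset)

lemma comp_ide' [simp]: "\<lbrakk>f \<in> Arr C; Dom C f = A\<rbrakk> \<Longrightarrow> f \<cdot> Ide C A = f"
  using comp_ide[of f A "Cod C f"] by (auto simp: mem_homset)

lemma ide_comp' [simp]: "\<lbrakk>f \<in> Arr C; Cod C f = A\<rbrakk> \<Longrightarrow> Ide C A \<cdot> f = f"
  using ide_comp[of f "Dom C f" A] by (auto simp: mem_homset)

lemma comp_assoc' [simp]:
  "\<lbrakk>f \<in> Arr C; g \<in> Arr C; h \<in> Arr C; Dom C g = Cod C f; Dom C h = Cod C g\<rbrakk>
    \<Longrightarrow> (h \<cdot> g) \<cdot> f = h \<cdot> (g \<cdot> f)"
  using comp_assoc[of f "Dom C f" "Cod C f" g "Cod C g" h "Cod C h"] by (auto simp: mem_homset)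

end

section \<open>Using and establishing universal properties\<close>

lemma is_terminal_unique:
  "\<lbrakk>is_terminal C T; A \<in> Obj C; f \<in> homset C A T; g \<in> homset C A T\<rbrakk> \<Longrightarrow> f = g"
  by (auto simp: is_terminal_def)

lemma is_product_ex:
  assumes "is_product C A B Q p q" "f \<in> Arr C" "g \<in> Arr C" "Dom C f = Z" "Dom C g = Z"
    "Cod C f = A" "Cod C g = B" "Z \<in> Obj C"
  obtains h where "h \<in> Arr C" "Dom C h = Z" "Cod C h = Q" "p \<cdot>\<^bsub>C\<^esub> h = f" "q \<cdot>\<^bsub>C\<^esub> h = g"
proof -
  have "\<exists>!h. h \<in> homset C Z Q \<and> p \<cdot>\<^bsub>C\<^esub> h = f \<and> q \<cdot>\<^bsub>C\<^esub> h = g"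
    using assms(1-8) by (simp add: is_product_def mem_homset)
  then show ?thesis using that by (auto simp: mem_homset)
qed

text \<open>The two projections are jointly monic: both arrows solve the factorisation problem posed
  by the components of \<open>h\<close>.\<close>

lemma is_product_unique:
  assumes "is_product C A B Q p q" "category C" "h \<in> Arr C" "k \<in> Arr C" "Dom C h = Dom C k"
    "Cod C h = Q" "Cod C k = Q" "p \<cdot>\<^bsub>C\<^esub> h = p \<cdot>\<^bsub>C\<^esub> k" "q \<cdot>\<^bsub>C\<^esub> h = q \<cdot>\<^bsub>C\<^esub> k"
  shows "h = k"
proof -
  interpret category C by fact
  have "\<exists>!l. l \<in> homset C (Dom C h) Q \<and> p \<cdot>\<^bsub>C\<^esub> l = p \<cdot>\<^bsub>C\<^esub> h \<and> q \<cdot>\<^bsub>C\<^esub> l = q \<cdot>\<^bsub>C\<^esub> h"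
    using assms(1,3-) by (auto simp: is_product_def mem_homset)
  then show ?thesis using assms(3-) by (auto simp: mem_homset)
qed

text \<open>Separates the universal property into existence of factorisations and joint monicity of
  \<open>p\<close> and \<open>q\<close>, as the two call for different arguments.\<close>

lemma is_productI:
  assumes "category C" "A \<in> Obj C" "B \<in> Obj C" "Q \<in> Obj C" "p \<in> homset C Q A" "q \<in> homset C Q B"
    and "\<And>Z f g. \<lbrakk>Z \<in> Obj C; f \<in> homset C Z A; g \<in> homset C Z B\<rbrakk>
      \<Longrightarrow> \<exists>h \<in> homset C Z Q. p \<cdot>\<^bsub>C\<^esub> h = f \<and> q \<cdot>\<^bsub>C\<^esub> h = g"
    and "\<And>Z h k. \<lbrakk>h \<in> homset C Z Q; k \<in> homset C Z Q; p \<cdot>\<^bsub>C\<^esub> h = p \<cdot>\<^bsub>C\<^esub> k; q \<cdot>\<^bsub>C\<^esub> h = q \<cdot>\<^bsub>C\<^esub> k\<rbrakk>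
      \<Longrightarrow> h = k"
  shows "is_product C A B Q p q"
  unfolding is_product_def
proof (intro conjI ballI)
  fix Z f g
  assume "Z \<in> Obj C" "f \<in> homset C Z A" "g \<in> homset C Z B"
  then obtain h where "h \<in> homset C Z Q" "p \<cdot>\<^bsub>C\<^esub> h = f" "q \<cdot>\<^bsub>C\<^esub> h = g"
    using assms(7) by blast
  then show "\<exists>!h. h \<in> homset C Z Q \<and> p \<cdot>\<^bsub>C\<^esub> h = f \<and> q \<cdot>\<^bsub>C\<^esub> h = g"
    using assms(8) by (intro ex1I[of _ h]) auto
qed (use assms in auto)

section \<open>Calculus of the chosen finite products\<close>

context fp_category
begin

lemma trm_obj [simp]: "Trm C \<in> Obj C"
  using trm_terminal by (simp add: is_terminal_def)

lemma bang_simps [simp]: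
  assumes "A \<in> Obj C"
  shows "bang C A \<in> Arr C" "Dom C (bang C A) = A" "Cod C (bang C A) = Trm C"
proof -
  have "\<exists>!f. f \<in> homset C A (Trm C)"
    using trm_terminal assms by (simp add: is_terminal_def)
  from theI'[OF this] have "bang C A \<in> homset C A (Trm C)"
    by (simp add: bang_def)
  then show "bang C A \<in> Arr C" "Dom C (bang C A) = A" "Cod C (bang C A) = Trm C"
    by (auto simp: mem_homset)
qed

lemma bang_unique: "\<lbrakk>f \<in> Arr C; Cod C f = Trm C\<rbrakk> \<Longrightarrow> f = bang C (Dom C f)"
  by (rule is_terminal_unique[OF trm_terminal, of "Dom C f"]) (auto simp: mem_homset)

lemma bang_comp [simp]: "\<lbrakk>f \<in> Arr C; Cod C f = A\<rbrakk> \<Longrightarrow> bang C A \<cdot> f = bang C (Dom C f)"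
  by (subst bang_unique) auto

lemma bang_trm [simp]: "bang C (Trm C) = Ide C (Trm C)"
  using bang_unique[of "Ide C (Trm C)"] by simp

lemma prd_simps [simp]:
  assumes "A \<in> Obj C" "B \<in> Obj C"
  shows "Prd C A B \<in> Obj C"
    "Pr1 C A B \<in> Arr C" "Dom C (Pr1 C A B) = Prd C A B" "Cod C (Pr1 C A B) = A"
    "Pr2 C A B \<in> Arr C" "Dom C (Pr2 C A B) = Prd C A B" "Cod C (Pr2 C A B) = B"
  using prd_product[OF assms] by (auto simp: is_product_def mem_homset)

lemma tuple_the:
  assumes "f \<in> Arr C" "g \<in> Arr C" "Dom C f = Dom C g"
  shows "\<langle>f, g\<rangle> \<in> homset C (Dom C f) (Prd C (Cod C f) (Cod C g)) \<and>
    Pr1 C (Cod C f) (Cod C g) \<cdot> \<langle>f, g\<rangle> = f \<and> Pr2 C (Cod C f) (Cod C g) \<cdot> \<langle>f, g\<rangle> = g"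
proof -
  have "\<exists>!h. h \<in> homset C (Dom C f) (Prd C (Cod C f) (Cod C g)) \<and>
      Pr1 C (Cod C f) (Cod C g) \<cdot> h = f \<and> Pr2 C (Cod C f) (Cod C g) \<cdot> h = g"
    using prd_product[of "Cod C f" "Cod C g"] assms by (simp add: is_product_def mem_homset)
  from theI'[OF this] show ?thesis
    by (simp add: tuple_def)
qed

lemma tuple_simps [simp]:
  assumes "f \<in> Arr C" "g \<in> Arr C" "Dom C f = Dom C g"
  shows "\<langle>f, g\<rangle> \<in> Arr C" "Dom C \<langle>f, g\<rangle> = Dom C g" "Cod C \<langle>f, g\<rangle> = Prd C (Cod C f) (Cod C g)"
  using tuple_the[OF assms] assms by (auto simp: mem_homset)

lemma pr_tuple [simp]:
  assumes "f \<in> Arr C" "g \<in> Arr C" "Dom C f = Dom C g" "Cod C f = A" "Cod C g = B"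
  shows "Pr1 C A B \<cdot> \<langle>f, g\<rangle> = f" "Pr2 C A B \<cdot> \<langle>f, g\<rangle> = g"
  using tuple_the[OF assms(1-3)] assms by auto

text \<open>With composites bracketed to the right, \<open>pr_tuple\<close> cannot match a
  projection and a tuple that are followed by \<open>h\<close>; these are its reassociated
  forms.\<close>

lemma pr_tuple_comp [simp]:
  assumes "f \<in> Arr C" "g \<in> Arr C" "Dom C f = Dom C g" "Cod C f = A" "Cod C g = B"
    "h \<in> Arr C" "Cod C h = Dom C g"
  shows "Pr1 C A B \<cdot> \<langle>f, g\<rangle> \<cdot> h = f \<cdot> h" "Pr2 C A B \<cdot> \<langle>f, g\<rangle> \<cdot> h = g \<cdot> h"
proof -
  have "A \<in> Obj C" "B \<in> Obj C"
    using assms by auto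
  then show "Pr1 C A B \<cdot> \<langle>f, g\<rangle> \<cdot> h = f \<cdot> h" "Pr2 C A B \<cdot> \<langle>f, g\<rangle> \<cdot> h = g \<cdot> h"
    using assms by (simp_all flip: comp_assoc')
qed

lemma tuple_eqI:
  assumes "h \<in> Arr C" "k \<in> Arr C" "Dom C h = Dom C k" "Cod C h = Prd C A B" "Cod C k = Prd C A B"
    "A \<in> Obj C" "B \<in> Obj C"
    "Pr1 C A B \<cdot> h = Pr1 C A B \<cdot> k" "Pr2 C A B \<cdot> h = Pr2 C A B \<cdot> k"
  shows "h = k"
  using is_product_unique[OF prd_product category_axioms] assms by metis

lemma tuple_comp [simp]:
  assumes "f \<in> Arr C" "g \<in> Arr C" "Dom C f = Dom C g" "h \<in> Arr C" "Cod C h = Dom C g"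
  shows "\<langle>f, g\<rangle> \<cdot> h = \<langle>f \<cdot> h, g \<cdot> h\<rangle>"
  by (rule tuple_eqI[of _ _ "Cod C f" "Cod C g"]) (use assms in simp_all)

lemma tuple_pr [simp]:
  assumes "A \<in> Obj C" "B \<in> Obj C"
  shows "\<langle>Pr1 C A B, Pr2 C A B\<rangle> = Ide C (Prd C A B)"
  by (rule tuple_eqI[of _ _ A B]) (use assms in simp_all)

end

text \<open>Any arrow from \<open>Trm C\<close> to \<open>T\<close> inverts \<open>bang C T\<close>,
  since endomorphisms of a terminal object are identities. There is exactly one, so the description
  in \<open>inverse_arrow\<close> denotes it.\<close>

lemma (in fp_category) inverse_bang:
  assumes T: "is_terminal C T"
  shows "inverse_arrow C (bang C T) \<in> homset C (Trm C) T"
    "inverse_arrow C (bang C T) \<cdot> bang C T = Ide C T"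
    "bang C T \<cdot> inverse_arrow C (bang C T) = Ide C (Trm C)"
proof -
  have T_obj [simp]: "T \<in> Obj C" using T by (simp add: is_terminal_def)
  obtain t where t: "t \<in> Arr C" "Dom C t = Trm C" "Cod C t = T"
    using T unfolding is_terminal_def mem_homset by (metis trm_obj)
  have "t \<cdot> bang C T = Ide C T"
    by (rule is_terminal_unique[OF T T_obj]) (use t in \<open>auto simp: mem_homset\<close>)
  then have "\<exists>!g. g \<in> homset C (Cod C (bang C T)) (Dom C (bang C T)) \<and>
      g \<cdot> bang C T = Ide C (Dom C (bang C T)) \<and> bang C T \<cdot> g = Ide C (Cod C (bang C T))"
    using t by (intro ex1I[of _ t]) (auto simp: mem_homset intro: is_terminal_unique[OF T, of "Trm C"])
  from theI'[OF this] show "inverse_arrow C (bang C T) \<in> homset C (Trm C) T"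
    "inverse_arrow C (bang C T) \<cdot> bang C T = Ide C T"
    "bang C T \<cdot> inverse_arrow C (bang C T) = Ide C (Trm C)"
    by (simp_all add: inverse_arrow_def)
qed

section \<open>Functors\<close>

locale cat_functor =
  fixes C :: "('o, 'm, 'x) category_scheme" and D :: "('o2, 'm2, 'y) category_scheme"
    and F :: "('o, 'm, 'o2, 'm2) fctr"
  assumes is_functor: "is_functor C D F"
begin

sublocale dom: category C
  using is_functor by (simp add: is_functor_def)

sublocale cod: category D
  using is_functor by (simp add: is_functor_def)

lemma omap_obj [simp]: "A \<in> Obj C \<Longrightarrow> omap F A \<in> Obj D"
  using is_functor by (auto simp: is_functor_def)

lemma omap_extensional: "omap F \<in> extensional (Obj C)"
  using is_functor by (auto simp: is_functor_def PiE_def)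

lemma amap_extensional: "amap F \<in> extensional (Arr C)"
  using is_functor by (auto simp: is_functor_def PiE_def)

lemma amap_simps [simp]:
  assumes "f \<in> Arr C"
  shows "amap F f \<in> Arr D" "Dom D (amap F f) = omap F (Dom C f)"
    "Cod D (amap F f) = omap F (Cod C f)"
  using is_functor assms by (auto simp: is_functor_def PiE_def Pi_def mem_homset)

lemma amap_ide [simp]: "A \<in> Obj C \<Longrightarrow> amap F (Ide C A) = Ide D (omap F A)"
  using is_functor by (auto simp: is_functor_def)

lemma amap_comp:
  "\<lbrakk>f \<in> Arr C; g \<in> Arr C; Dom C g = Cod C f\<rbrakk> \<Longrightarrow> amap F (g \<cdot>\<^bsub>C\<^esub> f) = amap F g \<cdot>\<^bsub>D\<^esub> amap F f"
  using is_functor by (auto simp: is_functor_def)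

text \<open>The terminal objects \<open>S\<close> and \<open>T\<close> are isomorphic,
  \<open>F\<close> preserves isomorphisms, and an object isomorphic to a terminal one is
  terminal.\<close>

lemma is_terminal_transport:
  assumes "is_terminal C S" "is_terminal D (omap F S)" "is_terminal C T"
  shows "is_terminal D (omap F T)"
proof -
  obtain i j where i: "i \<in> homset C T S" and j: "j \<in> homset C S T"
    using assms unfolding is_terminal_def by metis
  have [simp]: "S \<in> Obj C" "T \<in> Obj C"
    using assms by (auto simp: is_terminal_def)
  have ji: "j \<cdot>\<^bsub>C\<^esub> i = Ide C T"
    by (rule is_terminal_unique[OF assms(3), of T]) (use i j in \<open>auto simp: mem_homset\<close>)
  have Fji: "amap F j \<cdot>\<^bsub>D\<^esub> amap F i = Ide D (omap F T)"
    using i j ji by (simp add: mem_homset flip: amap_comp)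
  have "\<exists>!f. f \<in> homset D Z (omap F T)" if Z: "Z \<in> Obj D" for Z
  proof -
    obtain k where k: "k \<in> homset D Z (omap F S)"
      using assms(2) Z unfolding is_terminal_def by metis
    have "f = amap F j \<cdot>\<^bsub>D\<^esub> k" if f: "f \<in> homset D Z (omap F T)" for f
    proof -
      have "amap F i \<cdot>\<^bsub>D\<^esub> f = k"
        by (rule is_terminal_unique[OF assms(2) Z]) (use f i k in \<open>auto simp: mem_homset\<close>)
      then have "amap F j \<cdot>\<^bsub>D\<^esub> k = (amap F j \<cdot>\<^bsub>D\<^esub> amap F i) \<cdot>\<^bsub>D\<^esub> f"
        using f i j by (auto simp: mem_homset)
      then show ?thesis
        using f Fji by (auto simp: mem_homset)
    qed
    moreover have "amap F j \<cdot>\<^bsub>D\<^esub> k \<in> homset D Z (omap F T)"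
      using j k by (auto simp: mem_homset)
    ultimately show ?thesis by blast
  qed
  then show ?thesis by (auto simp: is_terminal_def)
qed

text \<open>Two product cones over the same pair are linked by mutually inverse comparison arrows.
  Their images under \<open>F\<close> carry the universal property of the cone on
  \<open>omap F P\<close> over to the one on \<open>omap F Q\<close>.\<close>

lemma is_product_transport:
  assumes P: "is_product C A B P p1 p2" and Q: "is_product C A B Q q1 q2"
    and FP: "is_product D (omap F A) (omap F B) (omap F P) (amap F p1) (amap F p2)"
  shows "is_product D (omap F A) (omap F B) (omap F Q) (amap F q1) (amap F q2)"
proof -
  have objs [simp]: "A \<in> Obj C" "B \<in> Obj C" "P \<in> Obj C" "Q \<in> Obj C"
    and p [simp]: "p1 \<in> Arr C" "Dom C p1 = P" "Cod C p1 = A" "p2 \<in> Arr C" "Dom C p2 = P" "Cod C p2 = B"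
    and q [simp]: "q1 \<in> Arr C" "Dom C q1 = Q" "Cod C q1 = A" "q2 \<in> Arr C" "Dom C q2 = Q" "Cod C q2 = B"
    using P Q by (auto simp: is_product_def mem_homset)
  obtain i where i [simp]: "i \<in> Arr C" "Dom C i = Q" "Cod C i = P"
    and pi: "p1 \<cdot>\<^bsub>C\<^esub> i = q1" "p2 \<cdot>\<^bsub>C\<^esub> i = q2"
    by (rule is_product_ex[OF P, of q1 q2 Q]) auto
  obtain j where j [simp]: "j \<in> Arr C" "Dom C j = P" "Cod C j = Q"
    and qj: "q1 \<cdot>\<^bsub>C\<^esub> j = p1" "q2 \<cdot>\<^bsub>C\<^esub> j = p2"
    by (rule is_product_ex[OF Q, of p1 p2 P]) auto
  have ji: "j \<cdot>\<^bsub>C\<^esub> i = Ide C Q"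
    by (rule is_product_unique[OF Q dom.category_axioms])
      (simp_all add: pi qj flip: dom.comp_assoc')
  have Fji: "amap F j \<cdot>\<^bsub>D\<^esub> amap F i = Ide D (omap F Q)"
    by (simp add: ji flip: amap_comp)
  have Fpi: "amap F p1 \<cdot>\<^bsub>D\<^esub> amap F i = amap F q1" "amap F p2 \<cdot>\<^bsub>D\<^esub> amap F i = amap F q2"
    and Fqj: "amap F q1 \<cdot>\<^bsub>D\<^esub> amap F j = amap F p1" "amap F q2 \<cdot>\<^bsub>D\<^esub> amap F j = amap F p2"
    by (simp_all add: pi qj flip: amap_comp)
  show ?thesis
  proof (rule is_productI)
    fix Z f g
    assume "Z \<in> Obj D" and f: "f \<in> homset D Z (omap F A)" and g: "g \<in> homset D Z (omap F B)"
    then obtain h where h: "h \<in> Arr D" "Dom D h = Z" "Cod D h = omap F P"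
      "amap F p1 \<cdot>\<^bsub>D\<^esub> h = f" "amap F p2 \<cdot>\<^bsub>D\<^esub> h = g"
      by (elim is_product_ex[OF FP, of f g Z, rotated -1]) (auto simp: mem_homset)
    then show "\<exists>h \<in> homset D Z (omap F Q). amap F q1 \<cdot>\<^bsub>D\<^esub> h = f \<and> amap F q2 \<cdot>\<^bsub>D\<^esub> h = g"
      by (intro bexI[of _ "amap F j \<cdot>\<^bsub>D\<^esub> h"])
        (auto simp: Fqj mem_homset simp flip: cod.comp_assoc')
  next
    fix Z h k
    assume h: "h \<in> homset D Z (omap F Q)" and k: "k \<in> homset D Z (omap F Q)"
      and eq: "amap F q1 \<cdot>\<^bsub>D\<^esub> h = amap F q1 \<cdot>\<^bsub>D\<^esub> k" "amap F q2 \<cdot>\<^bsub>D\<^esub> h = amap F q2 \<cdot>\<^bsub>D\<^esub> k"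
    \<comment> \<open>For joint monicity the arrows are compared in \<open>omap F P\<close>;
      composing with \<open>amap F j\<close> then cancels \<open>amap F i\<close>.\<close>
    have "amap F i \<cdot>\<^bsub>D\<^esub> h = amap F i \<cdot>\<^bsub>D\<^esub> k"
      by (rule is_product_unique[OF FP cod.category_axioms])
        (use h k eq in \<open>auto simp: Fpi mem_homset simp flip: cod.comp_assoc'\<close>)
    then have "(amap F j \<cdot>\<^bsub>D\<^esub> amap F i) \<cdot>\<^bsub>D\<^esub> h = (amap F j \<cdot>\<^bsub>D\<^esub> amap F i) \<cdot>\<^bsub>D\<^esub> k"
      using h k by (auto simp: mem_homset)
    then show "h = k"
      using h k by (auto simp: Fji mem_homset)
  qed (auto simp: mem_homset cod.category_axioms)
qed

end

text \<open>Preservation is defined through every terminal object and every product cone; by the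
  transport lemmas it is enough to look at the chosen ones.\<close>

lemma preserves_finite_productsI:
  fixes C :: "('o, 'm, 'x) fp_category_scheme"
  assumes "fp_category C" "is_functor (C :: ('o, 'm, 'x) fp_category_scheme) D F"
    and trm: "is_terminal D (omap F (Trm C))"
    and prd: "\<And>A B. \<lbrakk>A \<in> Obj C; B \<in> Obj C\<rbrakk> \<Longrightarrow>
      is_product D (omap F A) (omap F B) (omap F (Prd C A B)) (amap F (Pr1 C A B)) (amap F (Pr2 C A B))"
  shows "preserves_finite_products C D F"
proof -
  interpret C: fp_category C by fact
  interpret F: cat_functor C D F by unfold_locales fact
  show ?thesis
    unfolding preserves_finite_products_def
  proof (intro conjI allI impI)
    fix A B Q p q
    assume Q: "is_product C A B Q p q"
    then have "A \<in> Obj C" "B \<in> Obj C" by (auto simp: is_product_def)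
    then show "is_product D (omap F A) (omap F B) (omap F Q) (amap F p) (amap F q)"
      using F.is_product_transport[OF C.prd_product Q] prd by blast
  qed (blast intro: F.is_terminal_transport[OF C.trm_terminal trm])
qed

section \<open>The Kleisli category\<close>

lemma kleisli_cat_simps [simp]:
  "Obj (kleisli_cat C X) = Obj C"
  "Dom (kleisli_cat C X) (A, g) = A"
  "Cod (kleisli_cat C X) (A, g) = Cod C g"
  "Ide (kleisli_cat C X) A = (A, Pr2 C X A)"
  "(B, h) \<cdot>\<^bsub>kleisli_cat C X\<^esub> (A, g) = (A, h \<cdot>\<^bsub>C\<^esub> \<langle>Pr1 C X A, g\<rangle>\<^bsub>C\<^esub>)"
  "Trm (kleisli_cat C X) = Trm C"
  "Prd (kleisli_cat C X) = Prd C"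
  "Pr1 (kleisli_cat C X) A B = (Prd C A B, Pr1 C A B \<cdot>\<^bsub>C\<^esub> Pr2 C X (Prd C A B))"
  "Pr2 (kleisli_cat C X) A B = (Prd C A B, Pr2 C A B \<cdot>\<^bsub>C\<^esub> Pr2 C X (Prd C A B))"
  by (simp_all add: kleisli_cat_def)

lemma kleisli_arr [simp]:
  "(A, g) \<in> Arr (kleisli_cat C X) \<longleftrightarrow> A \<in> Obj C \<and> g \<in> Arr C \<and> Dom C g = Prd C X A"
  by (simp add: kleisli_cat_def)

lemma kleisli_functor_simps [simp]:
  "A \<in> Obj C \<Longrightarrow> omap (kleisli_functor C X) A = A"
  "f \<in> Arr C \<Longrightarrow> amap (kleisli_functor C X) f = (Dom C f, f \<cdot>\<^bsub>C\<^esub> Pr2 C X (Dom C f))"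
  by (simp_all add: kleisli_functor_def)

locale kleisli_base = fp_category C
  for C :: "('o, 'm) fp_category" (structure) and X :: 'o +
  assumes X_obj [simp]: "X \<in> Obj C"
begin

abbreviation K where "K \<equiv> kleisli_cat C X"

text \<open>Pairing with the projection to \<open>X\<close> turns Kleisli composition into
  composition in \<open>C\<close>. The unit laws are the rules \<open>tuple_pr\<close> and
  \<open>pr_tuple\<close>, and associativity is \<open>tuple_comp\<close>.\<close>

lemma category_kleisli: "category K"
proof
  fix f assume "f \<in> Arr K"
  then show "Dom K f \<in> Obj K" "Cod K f \<in> Obj K"
    by (cases f; simp)+
next
  fix f g A B D assume "f \<in> homset K A B" "g \<in> homset K B D"
  then show "g \<cdot>\<^bsub>K\<^esub> f \<in> homset K A D"
    by (cases f; cases g; auto simp: mem_homset)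
next
  fix f A B assume "f \<in> homset K A B"
  then show "f \<cdot>\<^bsub>K\<^esub> Ide K A = f" "Ide K B \<cdot>\<^bsub>K\<^esub> f = f"
    by (cases f; auto simp: mem_homset)+
next
  fix f g h A B D E assume "f \<in> homset K A B" "g \<in> homset K B D" "h \<in> homset K D E"
  then show "(h \<cdot>\<^bsub>K\<^esub> g) \<cdot>\<^bsub>K\<^esub> f = h \<cdot>\<^bsub>K\<^esub> g \<cdot>\<^bsub>K\<^esub> f"
    by (cases f; cases g; cases h; auto simp: mem_homset)
qed (simp add: mem_homset)

text \<open>Arrows out of \<open>Z\<close> in \<open>K\<close> are arrows out of
  \<open>Prd C X Z\<close> in \<open>C\<close>, so the unique arrows and the pairings of
  \<open>C\<close> serve unchanged in \<open>K\<close>.\<close>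

lemma fp_category_kleisli: "fp_category K"
proof (intro fp_category.intro fp_category_axioms.intro category_kleisli)
  show "is_terminal K (Trm K)"
    unfolding is_terminal_def
  proof (intro conjI ballI)
    fix A assume "A \<in> Obj K"
    then show "\<exists>!f. f \<in> homset K A (Trm K)"
      by (intro ex1I[of _ "(A, bang C (Prd C X A))"])
        (auto simp: mem_homset intro: bang_unique[THEN trans])
  qed simp
next
  fix A B assume AB: "A \<in> Obj K" "B \<in> Obj K"
  show "is_product K A B (Prd K A B) (Pr1 K A B) (Pr2 K A B)"
  proof (rule is_productI[OF category_kleisli])
    fix Z f g assume "f \<in> homset K Z A" "g \<in> homset K Z B"
    then show "\<exists>h \<in> homset K Z (Prd K A B). Pr1 K A B \<cdot>\<^bsub>K\<^esub> h = f \<and> Pr2 K A B \<cdot>\<^bsub>K\<^esub> h = g"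
      by (intro bexI[of _ "(Z, \<langle>snd f, snd g\<rangle>)"]; cases f; cases g) (auto simp: mem_homset)
  next
    fix Z h k
    assume "h \<in> homset K Z (Prd K A B)" "k \<in> homset K Z (Prd K A B)"
      "Pr1 K A B \<cdot>\<^bsub>K\<^esub> h = Pr1 K A B \<cdot>\<^bsub>K\<^esub> k" "Pr2 K A B \<cdot>\<^bsub>K\<^esub> h = Pr2 K A B \<cdot>\<^bsub>K\<^esub> k"
    then show "h = k"
      using AB by (cases h; cases k) (auto simp: mem_homset intro: tuple_eqI[of _ _ A B])
  qed (use AB in \<open>auto simp: mem_homset\<close>)
qed

lemma is_functor_kleisli: "is_functor C K (kleisli_functor C X)"
  unfolding is_functor_def
proof (intro conjI ballI impI)
  show "omap (kleisli_functor C X) \<in> Obj C \<rightarrow>\<^sub>E Obj K"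
    by (auto simp: kleisli_functor_def)
  show "amap (kleisli_functor C X) \<in> (\<Pi>\<^sub>E f \<in> Arr C. homset K
    (omap (kleisli_functor C X) (Dom C f)) (omap (kleisli_functor C X) (Cod C f)))"
    by (auto simp: kleisli_functor_def mem_homset)
qed (auto simp: category_kleisli category_axioms)

text \<open>The projections of \<open>K\<close> are by construction the images of those of
  \<open>C\<close>, so chosen cones go to chosen cones.\<close>

lemma preserves_finite_products_kleisli: "preserves_finite_products C K (kleisli_functor C X)"
proof (rule preserves_finite_productsI[OF fp_category_axioms is_functor_kleisli])
  interpret K: fp_category K by (rule fp_category_kleisli)
  show "is_terminal K (omap (kleisli_functor C X) (Trm C))"
    using K.trm_terminal by simp
  show "is_product K (omap (kleisli_functor C X) A) (omap (kleisli_functor C X) B)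
      (omap (kleisli_functor C X) (Prd C A B)) (amap (kleisli_functor C X) (Pr1 C A B))
      (amap (kleisli_functor C X) (Pr2 C A B))"
    if "A \<in> Obj C" "B \<in> Obj C" for A B
    using K.prd_product[of A B] that by simp
qed

end

section \<open>Posets with finite meets\<close>

context finite_meet_poset
begin

lemma meet_eqI:
  assumes "x \<in> carrier L" "y \<in> carrier L" "z \<in> carrier L" "z \<sqsubseteq> x" "z \<sqsubseteq> y"
    "\<And>w. \<lbrakk>w \<in> carrier L; w \<sqsubseteq> x; w \<sqsubseteq> y\<rbrakk> \<Longrightarrow> w \<sqsubseteq> z"
  shows "x \<sqinter> y = z"
proof (rule le_antisym)
  show "x \<sqinter> y \<sqsubseteq> z" using assms(1,2) by (auto intro: assms(6) meet_left meet_right)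
qed (use assms in \<open>auto intro: meet_le\<close>)

lemma top_eqI: "\<lbrakk>t \<in> carrier L; \<And>x. x \<in> carrier L \<Longrightarrow> x \<sqsubseteq> t\<rbrakk> \<Longrightarrow> \<top> = t"
  by (intro le_antisym) auto

lemma meet_absorb: "\<lbrakk>x \<in> carrier L; y \<in> carrier L; x \<sqsubseteq> y\<rbrakk> \<Longrightarrow> y \<sqinter> x = x"
  by (intro meet_eqI) auto

lemma top_meet [simp]: "x \<in> carrier L \<Longrightarrow> \<top> \<sqinter> x = x"
  by (intro meet_absorb) auto

lemma meet_idem [simp]: "x \<in> carrier L \<Longrightarrow> x \<sqinter> x = x"
  by (intro meet_absorb) auto

lemma le_iff_meet_eq: "\<lbrakk>x \<in> carrier L; y \<in> carrier L\<rbrakk> \<Longrightarrow> x \<sqsubseteq> y \<longleftrightarrow> y \<sqinter> x = x"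
  using meet_absorb meet_left by metis

text \<open>Meeting with a fixed \<open>a\<close> preserves binary meets. The fibre maps of the
  1-arrow into the Kleisli doctrine have this shape, with \<open>a\<close> the reindexed
  \<phi>.\<close>

lemma meet_distrib:
  assumes "a \<in> carrier L" "x \<in> carrier L" "y \<in> carrier L"
  shows "(a \<sqinter> x) \<sqinter> (a \<sqinter> y) = a \<sqinter> (x \<sqinter> y)"
proof (rule meet_eqI)
  have "a \<sqinter> (x \<sqinter> y) \<sqsubseteq> x \<sqinter> y" "x \<sqinter> y \<sqsubseteq> x" "x \<sqinter> y \<sqsubseteq> y" "a \<sqinter> (x \<sqinter> y) \<sqsubseteq> a"
    using assms by (auto intro: meet_left meet_right)
  then show "a \<sqinter> (x \<sqinter> y) \<sqsubseteq> a \<sqinter> x" "a \<sqinter> (x \<sqinter> y) \<sqsubseteq> a \<sqinter> y"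
    using assms by (auto intro!: meet_le elim: le_trans)
next
  fix w assume w: "w \<in> carrier L" "w \<sqsubseteq> a \<sqinter> x" "w \<sqsubseteq> a \<sqinter> y"
  moreover have "a \<sqinter> x \<sqsubseteq> a" "a \<sqinter> x \<sqsubseteq> x" "a \<sqinter> y \<sqsubseteq> y"
    using assms by (auto intro: meet_left meet_right)
  ultimately have "w \<sqsubseteq> a" "w \<sqsubseteq> x" "w \<sqsubseteq> y"
    using assms by (meson le_trans meet_closed)+
  then show "w \<sqsubseteq> a \<sqinter> (x \<sqinter> y)"
    using assms w by (auto intro!: meet_le)
qed (use assms in auto)

end

section \<open>Principal lower sets, the fibres of the Kleisli doctrine\<close>

definition lower_set :: "'p gorder \<Rightarrow> 'p \<Rightarrow> 'p gorder"
  where "lower_set L a = L\<lparr>carrier := {x \<in> carrier L. x \<sqsubseteq>\<^bsub>L\<^esub> a}\<rparr>"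

lemma lower_set_simps [simp]:
  "x \<in> carrier (lower_set L a) \<longleftrightarrow> x \<in> carrier L \<and> x \<sqsubseteq>\<^bsub>L\<^esub> a"
  "le (lower_set L a) = le L"
  "eq (lower_set L a) = eq L"
  by (simp_all add: lower_set_def)

locale principal_lower_set = finite_meet_poset L for L :: "'p gorder" (structure) and a +
  assumes a_carrier [simp]: "a \<in> carrier L"
begin

lemma lower_set_meet_closed:
  assumes "x \<in> carrier (lower_set L a)" "y \<in> carrier (lower_set L a)"
  shows "x \<sqinter> y \<in> carrier (lower_set L a)"
proof -
  have "x \<sqinter> y \<sqsubseteq> x" using assms by (simp add: meet_left)
  then show ?thesis using assms by (auto elim: le_trans)
qed

text \<open>The greatest element is now \<open>a\<close>, and binary meets are those of
  \<open>L\<close>, because a meet of elements below \<open>a\<close> is again below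
  \<open>a\<close>.\<close>

lemma finite_meet_poset_lower_set: "finite_meet_poset (lower_set L a)"
proof unfold_locales
  show "\<exists>x. greatest (lower_set L a) x (carrier (lower_set L a))"
    by (rule exI[of _ a]) (simp add: greatest_def)
next
  fix x y
  assume xy: "x \<in> carrier (lower_set L a)" "y \<in> carrier (lower_set L a)"
  then have "greatest (lower_set L a) (x \<sqinter> y) (Lower (lower_set L a) {x, y})"
    using lower_set_meet_closed[OF xy]
    by (intro greatest_LowerI) (auto simp: Lower_def intro: meet_le meet_left meet_right)
  then show "\<exists>s. greatest (lower_set L a) s (Lower (lower_set L a) {x, y})" ..
qed (auto simp: eq_is_equal elim: le_trans)

lemma top_lower_set: "\<top>\<^bsub>lower_set L a\<^esub> = a"
proof -
  interpret S: finite_meet_poset "lower_set L a" by (rule finite_meet_poset_lower_set)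
  show ?thesis by (rule S.top_eqI) auto
qed

lemma meet_lower_set:
  assumes "x \<in> carrier (lower_set L a)" "y \<in> carrier (lower_set L a)"
  shows "x \<sqinter>\<^bsub>lower_set L a\<^esub> y = x \<sqinter> y"
proof -
  interpret S: finite_meet_poset "lower_set L a" by (rule finite_meet_poset_lower_set)
  show ?thesis
    using lower_set_meet_closed[OF assms] assms
    by (intro S.meet_eqI) (auto intro: meet_le meet_left meet_right)
qed

end

text \<open>The relation \<open>x \<sqsubseteq> y\<close> amounts to the equation
  \<open>y \<sqinter> x = x\<close>, which \<open>h\<close> preserves.\<close>

lemma preserves_finite_meets_isotone:
  assumes "preserves_finite_meets L M h" "finite_meet_poset L" "finite_meet_poset M"
    and h: "\<And>x. x \<in> carrier L \<Longrightarrow> h x \<in> carrier M"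
  shows "isotone L M h"
proof -
  interpret L: finite_meet_poset L by fact
  interpret M: finite_meet_poset M by fact
  show ?thesis
  proof (rule isotoneI)
    fix x y assume xy: "x \<in> carrier L" "y \<in> carrier L" "x \<sqsubseteq>\<^bsub>L\<^esub> y"
    then have "h y \<sqinter>\<^bsub>M\<^esub> h x = h x"
      using assms(1) unfolding preserves_finite_meets_def by (metis L.meet_absorb)
    then show "h x \<sqsubseteq>\<^bsub>M\<^esub> h y"
      using xy h by (simp add: M.le_iff_meet_eq)
  qed unfold_locales
qed

section \<open>Primary doctrines\<close>

context primary_doctrine
begin

sublocale base: fp_category "base P"
  by (rule base_fp)

declare reindex_ide [simp]

lemma reindex_carrier [simp]:
  "\<lbrakk>f \<in> Arr (base P); Dom (base P) f = A; \<alpha> \<in> carrier (fib P (Cod (base P) f))\<rbrakk>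
    \<Longrightarrow> reindex P f \<alpha> \<in> carrier (fib P A)"
  using reindex_closed[of f A "Cod (base P) f"] by (auto simp: mem_homset)

lemma reindex_le:
  "\<lbrakk>f \<in> Arr (base P); Dom (base P) f = A; Cod (base P) f = B; \<alpha> \<in> carrier (fib P B);
    \<beta> \<in> carrier (fib P B); \<alpha> \<sqsubseteq>\<^bsub>fib P B\<^esub> \<beta>\<rbrakk>
    \<Longrightarrow> reindex P f \<alpha> \<sqsubseteq>\<^bsub>fib P A\<^esub> reindex P f \<beta>"
  using reindex_mono[of f A B] by (auto simp: mem_homset isotone_def)

lemma reindex_reindex [simp]:
  "\<lbrakk>f \<in> Arr (base P); g \<in> Arr (base P); Dom (base P) g = Cod (base P) f;
    \<gamma> \<in> carrier (fib P (Cod (base P) g))\<rbrakk>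
    \<Longrightarrow> reindex P f (reindex P g \<gamma>) = reindex P (g \<cdot>\<^bsub>base P\<^esub> f) \<gamma>"
  using reindex_comp[of f "Dom (base P) f" "Cod (base P) f" g "Cod (base P) g"]
  by (auto simp: mem_homset)

lemma reindex_meet:
  "\<lbrakk>f \<in> Arr (base P); Dom (base P) f = A; Cod (base P) f = B; \<alpha> \<in> carrier (fib P B);
    \<beta> \<in> carrier (fib P B)\<rbrakk>
    \<Longrightarrow> reindex P f (\<alpha> \<sqinter>\<^bsub>fib P B\<^esub> \<beta>) = reindex P f \<alpha> \<sqinter>\<^bsub>fib P A\<^esub> reindex P f \<beta>"
  using reindex_meets[of f A B] by (auto simp: mem_homset preserves_finite_meets_def)

lemma reindex_top:
  "\<lbrakk>f \<in> Arr (base P); Dom (base P) f = A; Cod (base P) f = B\<rbrakk>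
    \<Longrightarrow> reindex P f \<top>\<^bsub>fib P B\<^esub> = \<top>\<^bsub>fib P A\<^esub>"
  using reindex_meets[of f A B] by (auto simp: mem_homset preserves_finite_meets_def)

end

section \<open>Primary 1-arrows\<close>

text \<open>Monotonicity of the fibre maps is derived here from preservation of meets.\<close>

lemma primary_one_arrowI:
  assumes P: "primary_doctrine P" and R: "primary_doctrine R"
    and F: "is_functor (base P) (base R) F" "preserves_finite_products (base P) (base R) F"
    and ext: "\<ff> \<in> extensional (Obj (base P))"
      "\<And>A. A \<in> Obj (base P) \<Longrightarrow> \<ff> A \<in> carrier (fib P A) \<rightarrow>\<^sub>E carrier (fib R (omap F A))"
    and nat: "\<And>f \<beta>. \<lbrakk>f \<in> Arr (base P); \<beta> \<in> carrier (fib P (Cod (base P) f))\<rbrakk> \<Longrightarrow>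
      \<ff> (Dom (base P) f) (reindex P f \<beta>) = reindex R (amap F f) (\<ff> (Cod (base P) f) \<beta>)"
    and meets: "\<And>A. A \<in> Obj (base P) \<Longrightarrow>
      preserves_finite_meets (fib P A) (fib R (omap F A)) (\<ff> A)"
  shows "primary_one_arrow P R (F, \<ff>)"
proof -
  interpret P: primary_doctrine P by fact
  interpret R: primary_doctrine R by fact
  interpret F: cat_functor "base P" "base R" F by unfold_locales fact
  have "isotone (fib P A) (fib R (omap F A)) (\<ff> A)" if "A \<in> Obj (base P)" for A
    using that meets P.fib_meets R.fib_meets ext(2)[OF that]
    by (intro preserves_finite_meets_isotone) auto
  then show ?thesis
    unfolding primary_one_arrow_def one_arrow_def prod.case
    using assms P.doctrine_axioms R.doctrine_axioms by (auto simp: mem_homset PiE_iff)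
qed

locale primary_arrow =
  fixes P :: "('o, 'm, 'p) doctrine" and R :: "('o2, 'm2, 'p2) doctrine"
    and F :: "('o, 'm, 'o2, 'm2) fctr" and \<ff> :: "'o \<Rightarrow> 'p \<Rightarrow> 'p2"
  assumes primary_one_arrow: "primary_one_arrow P R (F, \<ff>)"
begin

sublocale dom: primary_doctrine P
  using primary_one_arrow by (simp add: primary_one_arrow_def)

sublocale cod: primary_doctrine R
  using primary_one_arrow by (simp add: primary_one_arrow_def)

sublocale cat_functor "base P" "base R" F
  using primary_one_arrow by unfold_locales (simp add: primary_one_arrow_def one_arrow_def)

lemma preserves_finite_products: "preserves_finite_products (base P) (base R) F"
  using primary_one_arrow by (simp add: primary_one_arrow_def one_arrow_def)

lemma is_product_omap:
  "\<lbrakk>A \<in> Obj (base P); B \<in> Obj (base P)\<rbrakk> \<Longrightarrow> is_product (base R) (omap F A) (omap F B)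
    (omap F (Prd (base P) A B)) (amap F (Pr1 (base P) A B)) (amap F (Pr2 (base P) A B))"
  using preserves_finite_products dom.base.prd_product by (simp add: preserves_finite_products_def)

lemma is_terminal_omap: "is_terminal (base R) (omap F (Trm (base P)))"
  using preserves_finite_products dom.base.trm_terminal by (simp add: preserves_finite_products_def)

lemma map_PiE: "\<ff> \<in> (\<Pi>\<^sub>E A \<in> Obj (base P). carrier (fib P A) \<rightarrow>\<^sub>E carrier (fib R (omap F A)))"
  using primary_one_arrow by (simp add: primary_one_arrow_def one_arrow_def)

lemma map_carrier [simp]:
  "\<lbrakk>A \<in> Obj (base P); \<alpha> \<in> carrier (fib P A)\<rbrakk> \<Longrightarrow> \<ff> A \<alpha> \<in> carrier (fib R (omap F A))"
  using map_PiE by (blast dest: PiE_mem)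

lemma map_extensional: "\<ff> \<in> extensional (Obj (base P))"
  using map_PiE by (simp add: PiE_iff)

lemma map_extensional': "A \<in> Obj (base P) \<Longrightarrow> \<ff> A \<in> extensional (carrier (fib P A))"
  using map_PiE by (simp add: PiE_iff)

lemma map_reindex:
  "\<lbrakk>f \<in> Arr (base P); Dom (base P) f = A; Cod (base P) f = B; \<beta> \<in> carrier (fib P B)\<rbrakk>
    \<Longrightarrow> \<ff> A (reindex P f \<beta>) = reindex R (amap F f) (\<ff> B \<beta>)"
  using primary_one_arrow dom.base.dom_obj[of f] dom.base.cod_obj[of f]
  unfolding primary_one_arrow_def one_arrow_def by (auto simp: mem_homset)

lemma map_meet:
  "\<lbrakk>A \<in> Obj (base P); \<alpha> \<in> carrier (fib P A); \<beta> \<in> carrier (fib P A)\<rbrakk>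
    \<Longrightarrow> \<ff> A (\<alpha> \<sqinter>\<^bsub>fib P A\<^esub> \<beta>) = \<ff> A \<alpha> \<sqinter>\<^bsub>fib R (omap F A)\<^esub> \<ff> A \<beta>"
  using primary_one_arrow by (simp add: primary_one_arrow_def preserves_finite_meets_def)

text \<open>Reindexing along an identity is trivial, so the inequality of a 2-cell is reflexivity;
  the cell is its own inverse.\<close>

lemma invertible_id_two_cell:
  "invertible_two_cell P R (F, \<ff>) (F, \<ff>) (id_two_cell P R (F, \<ff>))"
proof -
  let ?i = "id_two_cell P R (F, \<ff>)"
  have "\<ff> A \<alpha> \<sqsubseteq>\<^bsub>fib R (omap F A)\<^esub> \<ff> A \<alpha>" if "A \<in> Obj (base P)" "\<alpha> \<in> carrier (fib P A)" for A \<alpha>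
  proof -
    interpret L: partial_order "fib R (omap F A)" using that by (simp add: cod.fib_poset)
    show ?thesis using that by simp
  qed
  then have "two_cell P R (F, \<ff>) (F, \<ff>) ?i"
    by (auto simp: two_cell_def is_nat_trans_def id_two_cell_def mem_homset)
  moreover have "vertical_comp P R ?i ?i = ?i"
    by (auto simp: vertical_comp_def id_two_cell_def intro!: restrict_ext)
  ultimately show ?thesis
    by (auto simp: invertible_two_cell_def)
qed

end

section \<open>The Kleisli doctrine\<close>

lemma kleisli_doctrine_simps [simp]:
  "base (kleisli_doctrine P X \<phi>) = kleisli_cat (base P) X"
  "fib (kleisli_doctrine P X \<phi>) A =
    lower_set (fib P (Prd (base P) X A)) (reindex P (Pr1 (base P) X A) \<phi>)"
  "reindex (kleisli_doctrine P X \<phi>) (A, g) = reindex P \<langle>Pr1 (base P) X A, g\<rangle>\<^bsub>base P\<^esub>"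
  by (simp_all add: kleisli_doctrine_def lower_set_def)

locale kleisli = primary_doctrine P
  for P :: "('o, 'm, 'p) doctrine" and X :: 'o and \<phi> :: 'p +
  assumes X_obj: "X \<in> Obj (base P)" and \<phi>_carrier [simp]: "\<phi> \<in> carrier (fib P X)"
begin

abbreviation C where "C \<equiv> base P"

sublocale kleisli_base C X
  by unfold_locales (rule X_obj)

abbreviation PX where "PX \<equiv> kleisli_doctrine P X \<phi>"
abbreviation FX where "FX \<equiv> kleisli_one_arrow P X \<phi>"

lemma lower: "A \<in> Obj C \<Longrightarrow> principal_lower_set (fib P (Prd C X A)) (reindex P (Pr1 C X A) \<phi>)"
  by (intro principal_lower_set.intro principal_lower_set_axioms.intro fib_meets) simp_all

lemmas finite_meet_poset_fib_PX = principal_lower_set.finite_meet_poset_lower_set[OF lower]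
lemmas top_fib_PX = principal_lower_set.top_lower_set[OF lower]
lemmas meet_fib_PX = principal_lower_set.meet_lower_set[OF lower]

text \<open>The first component of \<open>\<langle>Pr1, g\<rangle>\<close> is again a projection to
  \<open>X\<close>, so reindexing sends the bound over the codomain to the bound over
  \<open>A\<close>; monotonicity does the rest.\<close>

lemma reindex_PX_carrier:
  assumes "(A, g) \<in> Arr K" "\<alpha> \<in> carrier (fib PX (Cod C g))"
  shows "reindex PX (A, g) \<alpha> \<in> carrier (fib PX A)"
  using assms
  using reindex_le[of "\<langle>Pr1 C X A, g\<rangle>\<^bsub>C\<^esub>" "Prd C X A" "Prd C X (Cod C g)" \<alpha> "reindex P (Pr1 C X (Cod C g)) \<phi>"]
  by simp

text \<open>The top of a fibre is its bound, and bounds are sent to bounds; binary meets are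
  computed in the fibres of \<open>P\<close>.\<close>

lemma preserves_finite_meets_reindex_PX:
  assumes "(A, g) \<in> Arr K"
  shows "preserves_finite_meets (fib PX (Cod C g)) (fib PX A) (reindex PX (A, g))"
  unfolding preserves_finite_meets_def
proof (intro conjI ballI)
  fix x y assume "x \<in> carrier (fib PX (Cod C g))" "y \<in> carrier (fib PX (Cod C g))"
  then show "reindex PX (A, g) (x \<sqinter>\<^bsub>fib PX (Cod C g)\<^esub> y) =
      reindex PX (A, g) x \<sqinter>\<^bsub>fib PX A\<^esub> reindex PX (A, g) y"
    using assms reindex_PX_carrier[OF assms, of x] reindex_PX_carrier[OF assms, of y]
    by (simp add: meet_fib_PX reindex_meet)
qed (use assms in \<open>simp add: top_fib_PX\<close>)

text \<open>Sending \<open>g\<close> to \<open>\<langle>Pr1, g\<rangle>\<close> takes Kleisli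
  identities and composites to those of \<open>C\<close>, so functoriality of reindexing is
  inherited from \<open>P\<close>.\<close>

lemma primary_doctrine_PX: "primary_doctrine PX"
proof (intro primary_doctrine.intro doctrine.intro primary_doctrine_axioms.intro)
  show "fp_category (base PX)"
    using fp_category_kleisli by simp
  show "finite_meet_poset (fib PX A)" if "A \<in> Obj (base PX)" for A
    using that finite_meet_poset_fib_PX by simp
  then show "partial_order (fib PX A)" if "A \<in> Obj (base PX)" for A
    using that by (meson finite_meet_poset_def lower_semilattice_def)
  show "preserves_finite_meets (fib PX B) (fib PX A) (reindex PX f)"
    if "f \<in> homset (base PX) A B" for f A B
    using that preserves_finite_meets_reindex_PX by (cases f) (auto simp: mem_homset)
  show closed: "reindex PX f \<in> carrier (fib PX B) \<rightarrow> carrier (fib PX A)"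
    if "f \<in> homset (base PX) A B" for f A B
    using that reindex_PX_carrier by (cases f) (auto simp: mem_homset)
  show "isotone (fib PX B) (fib PX A) (reindex PX f)"
    if "f \<in> homset (base PX) A B" for f A B
    using that preserves_finite_meets_reindex_PX finite_meet_poset_fib_PX closed[OF that]
    by (cases f, intro preserves_finite_meets_isotone) (auto simp: mem_homset)
  show "reindex PX (Ide (base PX) A) \<alpha> = \<alpha>"
    if "A \<in> Obj (base PX)" "\<alpha> \<in> carrier (fib PX A)" for A \<alpha>
    using that by simp
  show "reindex PX (g \<cdot>\<^bsub>base PX\<^esub> f) \<gamma> = reindex PX f (reindex PX g \<gamma>)"
    if "f \<in> homset (base PX) A B" "g \<in> homset (base PX) B D" "\<gamma> \<in> carrier (fib PX D)" for f g A B D \<gamma>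
    using that by (cases f; cases g) (auto simp: mem_homset)
qed

section \<open>The 1-arrow into the Kleisli doctrine and its generic element\<close>

lemma snd_FX:
  "\<lbrakk>A \<in> Obj C; \<alpha> \<in> carrier (fib P A)\<rbrakk> \<Longrightarrow> snd FX A \<alpha> =
    reindex P (Pr1 C X A) \<phi> \<sqinter>\<^bsub>fib P (Prd C X A)\<^esub> reindex P (Pr2 C X A) \<alpha>"
  by (simp add: kleisli_one_arrow_def)

lemma fst_FX: "fst FX = kleisli_functor C X"
  by (simp add: kleisli_one_arrow_def)

lemma snd_FX_carrier:
  assumes "A \<in> Obj C" "\<alpha> \<in> carrier (fib P A)"
  shows "snd FX A \<alpha> \<in> carrier (fib PX A)"
proof -
  interpret L: finite_meet_poset "fib P (Prd C X A)" using assms by (simp add: fib_meets)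
  show ?thesis using assms by (simp add: snd_FX L.meet_left)
qed

lemma preserves_finite_meets_FX:
  assumes "A \<in> Obj C"
  shows "preserves_finite_meets (fib P A) (fib PX A) (snd FX A)"
proof -
  interpret A: finite_meet_poset "fib P A" using assms by (simp add: fib_meets)
  interpret L: finite_meet_poset "fib P (Prd C X A)" using assms by (simp add: fib_meets)
  show ?thesis
    unfolding preserves_finite_meets_def
  proof (intro conjI ballI)
    show "snd FX A \<top>\<^bsub>fib P A\<^esub> = \<top>\<^bsub>fib PX A\<^esub>"
      \<comment> \<open>The rule \<open>top_meet\<close> expects \<open>\<top>\<close> on the left,
        hence the commuted instance.\<close>
      using assms by (simp add: snd_FX top_fib_PX reindex_top meet_comm[of "fib P (Prd C X A)" _ "\<top>\<^bsub>fib P (Prd C X A)\<^esub>"])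
    fix x y assume xy: "x \<in> carrier (fib P A)" "y \<in> carrier (fib P A)"
    then show "snd FX A (x \<sqinter>\<^bsub>fib P A\<^esub> y) = snd FX A x \<sqinter>\<^bsub>fib PX A\<^esub> snd FX A y"
      using assms snd_FX_carrier[of A x] snd_FX_carrier[of A y]
      by (simp add: meet_fib_PX) (simp add: snd_FX reindex_meet L.meet_distrib)
  qed
qed

lemma primary_one_arrow_FX: "primary_one_arrow P PX FX"
proof -
  have "primary_one_arrow P PX (kleisli_functor C X, snd FX)"
  proof (rule primary_one_arrowI[OF primary_doctrine_axioms primary_doctrine_PX])
    show "snd FX A \<in> carrier (fib P A) \<rightarrow>\<^sub>E carrier (fib PX (omap (kleisli_functor C X) A))"
      if "A \<in> Obj C" for A
      using that snd_FX_carrier by (auto simp: PiE_iff) (simp add: kleisli_one_arrow_def)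
    show "snd FX \<in> extensional (Obj C)"
      by (simp add: kleisli_one_arrow_def)
    \<comment> \<open>Both sides are the meet of the reindexed \<phi> with \<beta> reindexed along
      \<open>f\<close> after the second projection.\<close>
    show "snd FX (Dom C f) (reindex P f \<beta>) =
        reindex PX (amap (kleisli_functor C X) f) (snd FX (Cod C f) \<beta>)"
      if "f \<in> Arr C" "\<beta> \<in> carrier (fib P (Cod C f))" for f \<beta>
      using that by (simp add: snd_FX reindex_meet)
  qed (use is_functor_kleisli preserves_finite_products_kleisli preserves_finite_meets_FX in simp_all)
  then show ?thesis
    by (simp add: kleisli_one_arrow_def)
qed

lemma generic_element_hom: "generic_element C X \<in> homset K (Trm K) X"
  by (simp add: generic_element_def mem_homset)

text \<open>Reindexing along \<open>\<langle>Pr1, Pr1\<rangle>\<close> makes both factors of the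
  meet equal to the bound of the fibre over the terminal object, which is its top.\<close>

lemma top_le_generic_element:
  "\<top>\<^bsub>fib PX (Trm K)\<^esub> \<sqsubseteq>\<^bsub>fib PX (Trm K)\<^esub> reindex PX (generic_element C X) (snd FX X \<phi>)"
proof -
  interpret L: finite_meet_poset "fib P (Prd C X (Trm C))" by (simp add: fib_meets)
  show ?thesis
    by (simp add: generic_element_def snd_FX top_fib_PX reindex_meet)
qed

end

section \<open>The universal property\<close>

locale kleisli_target = kleisli P X \<phi> + G: primary_arrow P R G \<gg>
  for P :: "('o, 'm, 'p) doctrine" and X :: 'o and \<phi> :: 'p
    and R :: "('o2, 'm2, 'p2) doctrine" and G :: "('o, 'm, 'o2, 'm2) fctr"
    and \<gg> :: "'o \<Rightarrow> 'p \<Rightarrow> 'p2" +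
  fixes c :: 'm2
  assumes c_hom: "c \<in> homset (base R) (Trm (base R)) (omap G X)"
    and top_le_c: "\<top>\<^bsub>fib R (Trm (base R))\<^esub> \<sqsubseteq>\<^bsub>fib R (Trm (base R))\<^esub> reindex R c (\<gg> X \<phi>)"
begin

abbreviation D where "D \<equiv> base R"

lemma c_simps [simp]: "c \<in> Arr D" "Dom D c = Trm D" "Cod D c = omap G X"
  using c_hom by (auto simp: mem_homset)

lemma reindex_c: "reindex R c (\<gg> X \<phi>) = \<top>\<^bsub>fib R (Trm D)\<^esub>"
proof -
  interpret L: finite_meet_poset "fib R (Trm D)" by (simp add: G.cod.fib_meets)
  show ?thesis using top_le_c by (intro L.le_antisym) auto
qed

text \<open>The arrow \<open>\<langle>c \<circ> !, id\<rangle>\<close>. A description replaces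
  \<open>tuple\<close> because \<open>omap G (Prd C X A)\<close> is a product of
  \<open>omap G X\<close> and \<open>omap G A\<close>, but perhaps not the chosen one.\<close>

definition point :: "'o \<Rightarrow> 'm2" where
  "point A = (THE w. w \<in> homset D (omap G A) (omap G (Prd C X A)) \<and>
    amap G (Pr1 C X A) \<cdot>\<^bsub>D\<^esub> w = c \<cdot>\<^bsub>D\<^esub> bang D (omap G A) \<and>
    amap G (Pr2 C X A) \<cdot>\<^bsub>D\<^esub> w = Ide D (omap G A))"

lemma point_simps [simp]:
  assumes "A \<in> Obj C"
  shows "point A \<in> Arr D" "Dom D (point A) = omap G A" "Cod D (point A) = omap G (Prd C X A)"
    "amap G (Pr1 C X A) \<cdot>\<^bsub>D\<^esub> point A = c \<cdot>\<^bsub>D\<^esub> bang D (omap G A)"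
    "amap G (Pr2 C X A) \<cdot>\<^bsub>D\<^esub> point A = Ide D (omap G A)"
proof -
  have "\<exists>!w. w \<in> homset D (omap G A) (omap G (Prd C X A)) \<and>
    amap G (Pr1 C X A) \<cdot>\<^bsub>D\<^esub> w = c \<cdot>\<^bsub>D\<^esub> bang D (omap G A) \<and>
    amap G (Pr2 C X A) \<cdot>\<^bsub>D\<^esub> w = Ide D (omap G A)"
    using G.is_product_omap[of X A] assms by (simp add: is_product_def mem_homset)
  from theI'[OF this] show "point A \<in> Arr D" "Dom D (point A) = omap G A"
    "Cod D (point A) = omap G (Prd C X A)"
    "amap G (Pr1 C X A) \<cdot>\<^bsub>D\<^esub> point A = c \<cdot>\<^bsub>D\<^esub> bang D (omap G A)"
    "amap G (Pr2 C X A) \<cdot>\<^bsub>D\<^esub> point A = Ide D (omap G A)"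
    by (simp_all add: point_def mem_homset)
qed

text \<open>Collects a projection and its successor under one \<open>amap G\<close>, where the tuple
  rules of \<open>C\<close> can act.\<close>

lemma amap_pr_comp [simp]:
  assumes "A \<in> Obj C" "B \<in> Obj C" "f \<in> Arr C" "Cod C f = Prd C A B" "w \<in> Arr D"
    "Cod D w = omap G (Dom C f)"
  shows "amap G (Pr1 C A B) \<cdot>\<^bsub>D\<^esub> amap G f \<cdot>\<^bsub>D\<^esub> w = amap G (Pr1 C A B \<cdot>\<^bsub>C\<^esub> f) \<cdot>\<^bsub>D\<^esub> w"
    "amap G (Pr2 C A B) \<cdot>\<^bsub>D\<^esub> amap G f \<cdot>\<^bsub>D\<^esub> w = amap G (Pr2 C A B \<cdot>\<^bsub>C\<^esub> f) \<cdot>\<^bsub>D\<^esub> w"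
  using assms by (simp_all add: G.amap_comp)

lemma amap_pr_point_comp [simp]:
  assumes "A \<in> Obj C" "w \<in> Arr D" "Cod D w = omap G A"
  shows "amap G (Pr1 C X A) \<cdot>\<^bsub>D\<^esub> point A \<cdot>\<^bsub>D\<^esub> w = c \<cdot>\<^bsub>D\<^esub> bang D (Dom D w)"
    "amap G (Pr2 C X A) \<cdot>\<^bsub>D\<^esub> point A \<cdot>\<^bsub>D\<^esub> w = w"
proof -
  \<comment> \<open>The rules \<open>point_simps(4,5)\<close> are held back, as they would rewrite
    the bracketed composite before it is reassociated.\<close>
  have "amap G (Pr1 C X A) \<cdot>\<^bsub>D\<^esub> point A \<cdot>\<^bsub>D\<^esub> w = (amap G (Pr1 C X A) \<cdot>\<^bsub>D\<^esub> point A) \<cdot>\<^bsub>D\<^esub> w"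
    "amap G (Pr2 C X A) \<cdot>\<^bsub>D\<^esub> point A \<cdot>\<^bsub>D\<^esub> w = (amap G (Pr2 C X A) \<cdot>\<^bsub>D\<^esub> point A) \<cdot>\<^bsub>D\<^esub> w"
    using assms by (simp_all del: point_simps(4,5))
  then show "amap G (Pr1 C X A) \<cdot>\<^bsub>D\<^esub> point A \<cdot>\<^bsub>D\<^esub> w = c \<cdot>\<^bsub>D\<^esub> bang D (Dom D w)"
    "amap G (Pr2 C X A) \<cdot>\<^bsub>D\<^esub> point A \<cdot>\<^bsub>D\<^esub> w = w"
    using assms by simp_all
qed

text \<open>Both arrows have components \<open>c \<circ> !\<close> and \<open>v\<close> with respect
  to the product cone on \<open>omap G (Prd C X A)\<close>.\<close>

lemma point_unique:
  assumes "A \<in> Obj C" "w \<in> Arr D" "Dom D w = omap G B" "Cod D w = omap G (Prd C X A)"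
    "v \<in> Arr D" "Dom D v = omap G B" "Cod D v = omap G A" "B \<in> Obj C"
    "amap G (Pr1 C X A) \<cdot>\<^bsub>D\<^esub> w = c \<cdot>\<^bsub>D\<^esub> bang D (omap G B)" "amap G (Pr2 C X A) \<cdot>\<^bsub>D\<^esub> w = v"
  shows "w = point A \<cdot>\<^bsub>D\<^esub> v"
  by (rule is_product_unique[OF G.is_product_omap G.cod.base.category_axioms, of X A])
    (use assms in simp_all)

text \<open>Both sides have components \<open>c \<circ> !\<close> and
  \<open>amap G g \<circ> point A\<close>. This identity makes the extension compatible with Kleisli
  composition and with reindexing.\<close>

lemma point_natural:
  assumes "(A, g) \<in> Arr K"
  shows "amap G \<langle>Pr1 C X A, g\<rangle>\<^bsub>C\<^esub> \<cdot>\<^bsub>D\<^esub> point A = point (Cod C g) \<cdot>\<^bsub>D\<^esub> amap G g \<cdot>\<^bsub>D\<^esub> point A"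
  using assms by (intro point_unique[of _ _ A]) simp_all

section \<open>Construction of the extension\<close>

definition ext_functor :: "('o, 'o \<times> 'm, 'o2, 'm2) fctr" where
  "ext_functor = \<lparr>omap = omap G, amap = restrict (\<lambda>(A, g). amap G g \<cdot>\<^bsub>D\<^esub> point A) (Arr K)\<rparr>"

definition ext_map :: "'o \<Rightarrow> 'p \<Rightarrow> 'p2" where
  "ext_map = (\<lambda>A \<in> Obj C. \<lambda>\<alpha> \<in> carrier (fib PX A). reindex R (point A) (\<gg> (Prd C X A) \<alpha>))"

lemma omap_ext [simp]: "omap ext_functor = omap G"
  by (simp add: ext_functor_def)

lemma amap_ext [simp]: "(A, g) \<in> Arr K \<Longrightarrow> amap ext_functor (A, g) = amap G g \<cdot>\<^bsub>D\<^esub> point A"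
  by (simp add: ext_functor_def)

lemma ext_map_apply [simp]:
  "\<lbrakk>A \<in> Obj C; \<alpha> \<in> carrier (fib PX A)\<rbrakk>
    \<Longrightarrow> ext_map A \<alpha> = reindex R (point A) (\<gg> (Prd C X A) \<alpha>)"
  by (simp add: ext_map_def)

text \<open>Identities are preserved because \<open>point A\<close> is a section of the image of the
  second projection; for composites, \<open>point_natural\<close> moves \<open>point\<close> past
  the image of a pairing.\<close>

lemma is_functor_ext: "is_functor K D ext_functor"
  unfolding is_functor_def
proof (intro conjI ballI impI)
  show "omap ext_functor \<in> Obj K \<rightarrow>\<^sub>E Obj D"
    using G.omap_extensional by (auto simp: PiE_iff)
  show "amap ext_functor \<in> (\<Pi>\<^sub>E f \<in> Arr K. homset D
      (omap ext_functor (Dom K f)) (omap ext_functor (Cod K f)))"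
  proof (rule PiE_I)
    fix f assume "f \<in> Arr K"
    then show "amap ext_functor f \<in> homset D (omap ext_functor (Dom K f)) (omap ext_functor (Cod K f))"
      by (cases f) (simp add: mem_homset)
  qed (simp add: ext_functor_def)
  show "amap ext_functor (Ide K A) = Ide D (omap ext_functor A)" if "A \<in> Obj K" for A
    using that by simp
  show "amap ext_functor (g \<cdot>\<^bsub>K\<^esub> f) = amap ext_functor g \<cdot>\<^bsub>D\<^esub> amap ext_functor f"
    if "f \<in> Arr K" "g \<in> Arr K" "Cod K f = Dom K g" for f g
    using that by (cases f; cases g) (auto simp: G.amap_comp point_natural)
qed (simp_all add: category_kleisli G.cod.base.category_axioms)

text \<open>A projection of \<open>K\<close> is one of \<open>C\<close> after a second projection,
  which \<open>point\<close> cancels. The extension thus has the same values on chosen cones as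
  \<open>G\<close>.\<close>

lemma preserves_finite_products_ext: "preserves_finite_products K D ext_functor"
proof (rule preserves_finite_productsI[OF fp_category_kleisli is_functor_ext])
  show "is_terminal D (omap ext_functor (Trm K))"
    by (simp add: G.is_terminal_omap)
  fix A B assume "A \<in> Obj K" "B \<in> Obj K"
  then show "is_product D (omap ext_functor A) (omap ext_functor B) (omap ext_functor (Prd K A B))
      (amap ext_functor (Pr1 K A B)) (amap ext_functor (Pr2 K A B))"
    using G.is_product_omap[of A B] by (simp add: G.amap_comp)
qed

text \<open>The first component of \<open>point A\<close> factors through \<open>c\<close>, so the
  element is reindexed from the top element \<open>reindex R c (\<gg> X \<phi>)\<close>. Here the
  condition on \<open>c\<close> enters.\<close>

lemma reindex_point_pr1:
  assumes "A \<in> Obj C"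
  shows "reindex R (point A) (\<gg> (Prd C X A) (reindex P (Pr1 C X A) \<phi>)) = \<top>\<^bsub>fib R (omap G A)\<^esub>"
proof -
  have "reindex R (point A) (\<gg> (Prd C X A) (reindex P (Pr1 C X A) \<phi>)) =
      reindex R (bang D (omap G A)) (reindex R c (\<gg> X \<phi>))"
    using assms by (simp add: G.map_reindex[of _ _ X])
  \<comment> \<open>The two reindexings are kept apart so that \<open>reindex_c\<close>
    applies.\<close>
  also have "\<dots> = \<top>\<^bsub>fib R (omap G A)\<^esub>"
    using assms by (simp add: reindex_c G.cod.reindex_top del: G.cod.reindex_reindex)
  finally show ?thesis .
qed

lemma preserves_finite_meets_ext:
  assumes "A \<in> Obj C"
  shows "preserves_finite_meets (fib PX A) (fib R (omap G A)) (ext_map A)"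
  unfolding preserves_finite_meets_def
proof (intro conjI ballI)
  interpret L: finite_meet_poset "fib P (Prd C X A)" using assms by (simp add: fib_meets)
  show "ext_map A \<top>\<^bsub>fib PX A\<^esub> = \<top>\<^bsub>fib R (omap G A)\<^esub>"
    using assms reindex_point_pr1 by (simp add: top_fib_PX)
  fix x y assume xy: "x \<in> carrier (fib PX A)" "y \<in> carrier (fib PX A)"
  have "x \<sqinter>\<^bsub>fib PX A\<^esub> y \<in> carrier (fib PX A)"
    using principal_lower_set.lower_set_meet_closed[OF lower] meet_fib_PX assms xy by simp
  then show "ext_map A (x \<sqinter>\<^bsub>fib PX A\<^esub> y) = ext_map A x \<sqinter>\<^bsub>fib R (omap G A)\<^esub> ext_map A y"
    using assms xy by (simp add: meet_fib_PX G.map_meet G.cod.reindex_meet)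
qed

lemma primary_one_arrow_ext: "primary_one_arrow PX R (ext_functor, ext_map)"
proof (rule primary_one_arrowI[OF primary_doctrine_PX G.cod.primary_doctrine_axioms])
  show "is_functor (base PX) D ext_functor" "preserves_finite_products (base PX) D ext_functor"
    using is_functor_ext preserves_finite_products_ext by simp_all
  show "ext_map \<in> extensional (Obj (base PX))"
    by (simp add: ext_map_def)
  show "ext_map A \<in> carrier (fib PX A) \<rightarrow>\<^sub>E carrier (fib R (omap ext_functor A))"
    if "A \<in> Obj (base PX)" for A
    using that by (auto simp: ext_map_def)
  show "preserves_finite_meets (fib PX A) (fib R (omap ext_functor A)) (ext_map A)"
    if "A \<in> Obj (base PX)" for A
    using that preserves_finite_meets_ext by simp
  fix f \<beta> assume f: "f \<in> Arr (base PX)" and \<beta>: "\<beta> \<in> carrier (fib PX (Cod (base PX) f))"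
  obtain A g where [simp]: "f = (A, g)" by (cases f)
  have g: "A \<in> Obj C" "g \<in> Arr C" "Dom C g = Prd C X A" using f by simp_all
  \<comment> \<open>Naturality of \<open>\<gg>\<close> along the pairing of the projection with
    \<open>g\<close> comes first; then \<open>point_natural\<close> exchanges \<open>point A\<close>
    for \<open>point (Cod C g)\<close>.\<close>
  have "ext_map A (reindex PX (A, g) \<beta>) = reindex R (point A) (\<gg> (Prd C X A) (reindex PX (A, g) \<beta>))"
    using reindex_PX_carrier[of A g \<beta>] g \<beta> by (intro ext_map_apply) simp_all
  also have "\<dots> = reindex R (amap G \<langle>Pr1 C X A, g\<rangle>\<^bsub>C\<^esub> \<cdot>\<^bsub>D\<^esub> point A) (\<gg> (Prd C X (Cod C g)) \<beta>)"
    using g \<beta> by (simp add: G.map_reindex[of _ _ "Prd C X (Cod C g)"])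
  also have "\<dots> = reindex R (amap ext_functor (A, g)) (ext_map (Cod C g) \<beta>)"
    using g \<beta> by (simp add: point_natural)
  finally show "ext_map (Dom (base PX) f) (reindex PX f \<beta>) =
      reindex R (amap ext_functor f) (ext_map (Cod (base PX) f) \<beta>)"
    by simp
qed

text \<open>On arrows, \<open>point\<close> cancels the second projection introduced by the Kleisli
  functor. On fibres, the factor coming from \<phi> becomes \<open>\<top>\<close> and the other one
  returns \<open>\<gg> A \<alpha>\<close>.\<close>

lemma ext_comp_FX: "one_arrow_comp P (ext_functor, ext_map) FX = (G, \<gg>)"
proof -
  have 1: "compose (Obj C) (omap G) (omap (kleisli_functor C X)) = omap G"
    by (rule extensionalityI[OF compose_extensional G.omap_extensional]) (simp add: compose_eq)
  have 2: "compose (Arr C) (amap ext_functor) (amap (kleisli_functor C X)) = amap G"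
    by (rule extensionalityI[OF compose_extensional G.amap_extensional])
      (simp add: compose_eq G.amap_comp)
  have "ext_map A (snd FX A \<alpha>) = \<gg> A \<alpha>" if A: "A \<in> Obj C" and \<alpha>: "\<alpha> \<in> carrier (fib P A)" for A \<alpha>
  proof -
    interpret L: finite_meet_poset "fib R (omap G A)" using A by (simp add: G.cod.fib_meets)
    have "ext_map A (snd FX A \<alpha>) = reindex R (point A) (\<gg> (Prd C X A) (snd FX A \<alpha>))"
      using A \<alpha> snd_FX_carrier by (intro ext_map_apply)
    also have "\<dots> = reindex R (point A) (\<gg> (Prd C X A) (reindex P (Pr1 C X A) \<phi>))
        \<sqinter>\<^bsub>fib R (omap G A)\<^esub> reindex R (point A) (\<gg> (Prd C X A) (reindex P (Pr2 C X A) \<alpha>))"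
      using A \<alpha> by (simp add: snd_FX G.map_meet G.cod.reindex_meet del: G.cod.reindex_reindex)
    also have "\<dots> = \<gg> A \<alpha>"
      unfolding reindex_point_pr1[OF A] using A \<alpha> by (simp add: G.map_reindex[of _ _ A])
    finally show ?thesis .
  qed
  then have 3: "(\<lambda>A \<in> Obj C. compose (carrier (fib P A)) (ext_map (omap (fst FX) A)) (snd FX A)) = \<gg>"
    by (intro extensionalityI[OF restrict_extensional G.map_extensional])
      (auto simp: fst_FX compose_eq intro!: extensionalityI[OF compose_extensional G.map_extensional'])
  show ?thesis
    using 1 2 3 by (simp add: one_arrow_comp_def case_prod_beta fst_FX)
qed

text \<open>The generic element goes to the first component of \<open>point (Trm C)\<close>, that is
  to \<open>c \<circ> !\<close>, and the canonical isomorphism cancels the \<open>!\<close>.\<close>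

lemma from_terminal_ext:
  "from_terminal K D ext_functor (amap ext_functor (generic_element C X)) = c"
proof -
  have "omap G (Trm C) \<in> Obj D" by simp
  then show ?thesis
    using G.cod.base.inverse_bang[OF G.is_terminal_omap]
    by (simp add: from_terminal_def generic_element_def mem_homset)
qed

lemma kleisli_extension_ext: "kleisli_extension P X \<phi> R (G, \<gg>) c (ext_functor, ext_map)"
  by (simp add: kleisli_extension_def primary_one_arrow_ext ext_comp_FX from_terminal_ext)

section \<open>Uniqueness of the extension\<close>

lemma kleisli_extension_unique:
  assumes "kleisli_extension P X \<phi> R (G, \<gg>) c H"
  shows "H = (ext_functor, ext_map)"
proof -
  obtain H1 \<hh> where H [simp]: "H = (H1, \<hh>)" by (cases H)
  interpret H: primary_arrow PX R H1 \<hh>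
    using assms by unfold_locales (simp add: kleisli_extension_def)
  have comp: "one_arrow_comp P (H1, \<hh>) FX = (G, \<gg>)"
    and from_terminal: "from_terminal K D H1 (amap H1 (generic_element C X)) = c"
    using assms by (simp_all add: kleisli_extension_def)
  have G_eq: "G = \<lparr>omap = compose (Obj C) (omap H1) (omap (kleisli_functor C X)),
      amap = compose (Arr C) (amap H1) (amap (kleisli_functor C X))\<rparr>"
    and g_eq: "\<gg> = (\<lambda>A \<in> Obj C. compose (carrier (fib P A)) (\<hh> (omap (fst FX) A)) (snd FX A))"
    using comp by (simp_all add: one_arrow_comp_def case_prod_beta fst_FX)
  have omap: "omap H1 = omap G"
    using H.omap_extensional
    by (intro extensionalityI[OF _ G.omap_extensional]) (simp_all add: G_eq compose_eq)
  have amap: "amap H1 (Dom C f, f \<cdot>\<^bsub>C\<^esub> Pr2 C X (Dom C f)) = amap G f" if "f \<in> Arr C" for f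
    using that by (simp add: G_eq compose_eq)
  have map: "\<hh> A (snd FX A \<alpha>) = \<gg> A \<alpha>" if "A \<in> Obj C" "\<alpha> \<in> carrier (fib P A)" for A \<alpha>
    using that by (simp add: g_eq compose_eq fst_FX)
  \<comment> \<open>In \<open>K\<close>, the arrow \<open>g\<close> is the image of the
    \<open>C\<close>-arrow \<open>g\<close> after the identity of \<open>Prd C X A\<close> read as
    an arrow from \<open>A\<close> to \<open>Prd C X A\<close>; on such images \<open>H1\<close>
    agrees with \<open>G\<close>.\<close>
  have factor: "amap H1 (A, g) = amap G g \<cdot>\<^bsub>D\<^esub> amap H1 (A, Ide C (Prd C X A))"
    if "A \<in> Obj C" "g \<in> Arr C" "Dom C g = Prd C X A" for A g
    using that H.amap_comp[of "(A, Ide C (Prd C X A))" "(Prd C X A, g \<cdot>\<^bsub>C\<^esub> Pr2 C X (Prd C X A))"]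
      amap[of g] by simp
  \<comment> \<open>Composing with \<open>bang\<close> undoes the canonical isomorphism in
    \<open>from_terminal\<close>.\<close>
  have generic: "amap H1 (generic_element C X) = c \<cdot>\<^bsub>D\<^esub> bang D (omap G (Trm C))"
  proof -
    let ?a = "amap H1 (generic_element C X)" and ?b = "bang D (omap G (Trm C))"
    have a: "?a \<in> Arr D" "Dom D ?a = omap G (Trm C)"
      by (simp_all add: generic_element_def flip: omap)
    have "c \<cdot>\<^bsub>D\<^esub> ?b = (?a \<cdot>\<^bsub>D\<^esub> inverse_arrow D ?b) \<cdot>\<^bsub>D\<^esub> ?b"
      using from_terminal by (simp add: from_terminal_def omap)
    also have "\<dots> = ?a"
      using a G.cod.base.inverse_bang[OF G.is_terminal_omap] by (simp add: mem_homset)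
    finally show ?thesis ..
  qed
  have point: "amap H1 (A, Ide C (Prd C X A)) = point A" if A: "A \<in> Obj C" for A
  proof -
    let ?w = "amap H1 (A, Ide C (Prd C X A))" and ?b = "amap H1 (A, bang C (Prd C X A))"
    have w: "?w \<in> Arr D" "Dom D ?w = omap G A" "Cod D ?w = omap G (Prd C X A)"
      and b: "?b \<in> Arr D" "Dom D ?b = omap G A" "Cod D ?b = omap G (Trm C)"
      using A by (simp_all flip: omap)
    have "amap G (Pr1 C X A) \<cdot>\<^bsub>D\<^esub> ?w = amap H1 (A, Pr1 C X A)"
      using A by (simp add: factor[of A "Pr1 C X A"])
    \<comment> \<open>The first projection, read as an arrow from \<open>A\<close> to
      \<open>X\<close> in \<open>K\<close>, factors through the terminal object as the generic
      element after the unique arrow.\<close>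
    also have "\<dots> = amap H1 (generic_element C X) \<cdot>\<^bsub>D\<^esub> ?b"
      using A H.amap_comp[of "(A, bang C (Prd C X A))" "generic_element C X"]
      by (simp add: generic_element_def)
    also have "\<dots> = c \<cdot>\<^bsub>D\<^esub> bang D (omap G A)"
      using A b by (simp add: generic)
    finally have 1: "amap G (Pr1 C X A) \<cdot>\<^bsub>D\<^esub> ?w = c \<cdot>\<^bsub>D\<^esub> bang D (omap G A)" .
    \<comment> \<open>The second projection, read as an arrow of \<open>K\<close>, is the identity
      of \<open>A\<close>.\<close>
    have "amap G (Pr2 C X A) \<cdot>\<^bsub>D\<^esub> ?w = amap H1 (A, Pr2 C X A)"
      using A by (simp add: factor[of A "Pr2 C X A"])
    also have "\<dots> = Ide D (omap G A)"
      using A H.amap_ide[of A] by (simp add: omap)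
    finally have "?w = point A \<cdot>\<^bsub>D\<^esub> Ide D (omap G A)"
      using A w 1 by (intro point_unique[of _ _ A]) simp_all
    then show ?thesis using A by simp
  qed
  have amap_eq: "amap H1 = amap ext_functor"
  proof (rule extensionalityI)
    show "amap H1 \<in> extensional (Arr K)" "amap ext_functor \<in> extensional (Arr K)"
      using H.amap_extensional by (simp_all add: ext_functor_def)
    show "amap H1 f = amap ext_functor f" if "f \<in> Arr K" for f
      using that factor[of "fst f" "snd f"] by (cases f) (simp add: point)
  qed
  have map_eq: "\<hh> A \<alpha> = ext_map A \<alpha>" if A: "A \<in> Obj C" and \<alpha>: "\<alpha> \<in> carrier (fib PX A)" for A \<alpha>
  proof -
    interpret L: finite_meet_poset "fib P (Prd C X A)" using A by (simp add: fib_meets)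
    \<comment> \<open>Every element of the fibre over \<open>A\<close> is reindexed from one in the
      image of \<open>snd FX\<close>: the reindexing returns the meet of \<alpha> with the bound of
      the fibre, which absorbs into \<alpha>.\<close>
    have "\<alpha> = reindex PX (A, Ide C (Prd C X A)) (snd FX (Prd C X A) \<alpha>)"
      using A \<alpha> by (simp add: snd_FX reindex_meet L.meet_absorb)
    then have "\<hh> A \<alpha> = \<hh> A (reindex PX (A, Ide C (Prd C X A)) (snd FX (Prd C X A) \<alpha>))"
      by simp
    also have "\<dots> = reindex R (point A) (\<hh> (Prd C X A) (snd FX (Prd C X A) \<alpha>))"
      using A \<alpha> snd_FX_carrier[of "Prd C X A" \<alpha>]
      by (subst H.map_reindex[of _ _ "Prd C X A"]) (simp_all add: point)
    also have "\<dots> = ext_map A \<alpha>"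
      using A \<alpha> by (simp add: map)
    finally show ?thesis .
  qed
  have "\<hh> = ext_map"
  proof (rule extensionalityI)
    show "\<hh> \<in> extensional (Obj C)" "ext_map \<in> extensional (Obj C)"
      using H.map_extensional by (simp_all add: ext_map_def)
    show "\<hh> A = ext_map A" if A: "A \<in> Obj C" for A
    proof (rule extensionalityI)
      show "\<hh> A \<in> extensional (carrier (fib PX A))" "ext_map A \<in> extensional (carrier (fib PX A))"
        using H.map_extensional'[of A] A by (simp_all add: ext_map_def)
    qed (use A map_eq in auto)
  qed
  then show ?thesis
    using omap amap_eq by (auto intro: fctr.equality)
qed

end

section \<open>Universality, with uniqueness of the comparison 2-cell\<close>

theorem theorem6p2:
  fixes P :: "('o, 'm, 'p) doctrine" and X :: 'o and \<phi> :: 'p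
  assumes "primary_doctrine P" and "X \<in> Obj (base P)" and "\<phi> \<in> carrier (fib P X)"
  defines "PX \<equiv> kleisli_doctrine P X \<phi>"
    and "FX \<equiv> kleisli_one_arrow P X \<phi>"
    and "idX \<equiv> generic_element (base P) X"
  shows "primary_one_arrow P PX FX \<and>
    idX \<in> homset (base PX) (Trm (base PX)) X \<and>
    \<top>\<^bsub>fib PX (Trm (base PX))\<^esub> \<sqsubseteq>\<^bsub>fib PX (Trm (base PX))\<^esub> reindex PX idX (snd FX X \<phi>) \<and>
    (\<forall>(R :: ('o2, 'm2, 'p2) doctrine) G \<gg> c.
      primary_doctrine R \<longrightarrow> primary_one_arrow P R (G, \<gg>) \<longrightarrow>
      c \<in> homset (base R) (Trm (base R)) (omap G X) \<longrightarrow>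
      \<top>\<^bsub>fib R (Trm (base R))\<^esub> \<sqsubseteq>\<^bsub>fib R (Trm (base R))\<^esub> reindex R c (\<gg> X \<phi>) \<longrightarrow>
      (\<exists>H. kleisli_extension P X \<phi> R (G, \<gg>) c H) \<and>
      (\<forall>H K. kleisli_extension P X \<phi> R (G, \<gg>) c H \<longrightarrow> kleisli_extension P X \<phi> R (G, \<gg>) c K \<longrightarrow>
        (\<exists>!\<theta>. invertible_two_cell PX R H K \<theta> \<and>
          whisker P \<theta> FX = id_two_cell P R (one_arrow_comp P H FX))))"
proof -
  interpret kleisli P X \<phi>
    using assms(1-3) by (intro kleisli.intro kleisli_axioms.intro)
  show ?thesis
    unfolding PX_def FX_def idX_def
  proof (intro conjI allI impI)
    fix R :: "('o2, 'm2, 'p2) doctrine" and G \<gg> c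
    assume "primary_one_arrow P R (G, \<gg>)"
      "c \<in> homset (base R) (Trm (base R)) (omap G X)"
      "\<top>\<^bsub>fib R (Trm (base R))\<^esub> \<sqsubseteq>\<^bsub>fib R (Trm (base R))\<^esub> reindex R c (\<gg> X \<phi>)"
    then interpret kleisli_target P X \<phi> R G \<gg> c
      by unfold_locales
    let ?E = "(ext_functor, ext_map)"
    interpret E: primary_arrow "kleisli_doctrine P X \<phi>" R ext_functor ext_map
      by unfold_locales (rule primary_one_arrow_ext)
    show "\<exists>H. kleisli_extension P X \<phi> R (G, \<gg>) c H"
      using kleisli_extension_ext ..
    fix H K
    assume "kleisli_extension P X \<phi> R (G, \<gg>) c H" "kleisli_extension P X \<phi> R (G, \<gg>) c K"
    \<comment> \<open>Both extensions are equal to the constructed one, so only 2-cells from it to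
      itself remain.\<close>
    then have HK: "H = ?E" "K = ?E"
      by (simp_all only: kleisli_extension_unique)
    let ?id = "id_two_cell (kleisli_doctrine P X \<phi>) R ?E"
    \<comment> \<open>Whiskering with a functor that is the identity on objects returns \<theta>
      itself. The identity 2-cells of \<open>(G, \<gg>)\<close> and of the extension coincide, as
      both have the object map of \<open>G\<close>.\<close>
    have whisker: "whisker P \<theta> (kleisli_one_arrow P X \<phi>) = id_two_cell P R (G, \<gg>) \<longleftrightarrow> \<theta> = ?id"
      if \<theta>: "\<theta> \<in> extensional (Obj (base P))" for \<theta>
    proof -
      have "whisker P \<theta> (kleisli_one_arrow P X \<phi>) = \<theta>"
        by (rule extensionalityI[OF _ \<theta>])
          (simp_all add: whisker_def case_prod_beta fst_FX compose_eq)
      moreover have "id_two_cell P R (G, \<gg>) = ?id"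
        by (simp add: id_two_cell_def)
      ultimately show ?thesis by simp
    qed
    have id_extensional: "?id \<in> extensional (Obj (base P))"
      by (simp add: id_two_cell_def)
    show "\<exists>!\<theta>. invertible_two_cell (kleisli_doctrine P X \<phi>) R H K \<theta> \<and>
        whisker P \<theta> (kleisli_one_arrow P X \<phi>) =
          id_two_cell P R (one_arrow_comp P H (kleisli_one_arrow P X \<phi>))"
      unfolding HK ext_comp_FX
    proof (rule ex1I[of _ ?id])
      show "invertible_two_cell (kleisli_doctrine P X \<phi>) R ?E ?E ?id \<and>
          whisker P ?id (kleisli_one_arrow P X \<phi>) = id_two_cell P R (G, \<gg>)"
        using E.invertible_id_two_cell whisker[OF id_extensional] by simp
      fix \<theta>
      assume \<theta>: "invertible_two_cell (kleisli_doctrine P X \<phi>) R ?E ?E \<theta> \<and>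
          whisker P \<theta> (kleisli_one_arrow P X \<phi>) = id_two_cell P R (G, \<gg>)"
      then have "\<theta> \<in> extensional (Obj (base P))"
        by (simp add: invertible_two_cell_def two_cell_def is_nat_trans_def PiE_iff)
      with \<theta> show "\<theta> = ?id"
        using whisker by blast
    qed
  qed (use primary_one_arrow_FX generic_element_hom top_le_generic_element in simp_all)
qed

end
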